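(* Consider the one-dimensional (strip) PML equation in Laplace space on $\Omega=[-1,1]^3$, $$(sS_x)\,\mathbf P^{-1}\widetilde{\mathbf Q}=\mathbf A_x\frac{\partial\widetilde{\mathbf Q}}{\partial x}+\mathbf P^{-1}\widetilde{\mathbf F},\qquad \widetilde{\mathbf F}=\mathbf P\Big(S_x\widetilde{\mathbf F}_Q-\frac{d}{s+\alpha}\widetilde{\mathbf F}_{w_x}\Big),$$ with piecewise constant $d_x(x)=d\ge 0$ and $\alpha_x=\alpha\ge 0$, where $S_x=1+\frac{d}{s+\alpha}$, subject to the boundary conditions, for $\eta=x,y,z$, $$\tfrac{Z_\eta}{2}(1-\gamma_\eta)\widetilde v_\eta-\tfrac{1+\gamma_\eta}{2}\widetilde T_\eta=0\ \text{ at } x=-1,\qquad \tfrac{Z_\eta}{2}(1-\gamma_\eta)\widetilde v_\eta+\tfrac{1+\gamma_\eta}{2}\widetilde T_\eta=0\ \text{ at } x=1,$$ with real $|\gamma_\eta|\le 1$, and to the interface conditions $\widetilde{\mathbf T}^+=\widetilde{\mathbf T}^-$, $\widetilde{\mathbf v}^+-\widetilde{\mathbf v}^-=0$ at discontinuities of $d_x(x)$. Then for all $s\in\mathbb C$ with $\Re(s)\ge a>0$ we have $\Re(sS_x)\ge a>0$ and $$\big\|\sqrt{\Re(sS_x)}\,\widetilde{\mathbf Q}(\cdot,\cdot,\cdot,s)\big\|_P^2\le \|\widetilde{\mathbf Q}(\cdot,\cdot,\cdot,s)\|_P\,\|\widetilde{\mathbf F}(\cdot,\cdot,\cdot,s)\|_P+\widetilde{\mathrm{BT}},$$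 where $$\widetilde{\mathrm{BT}}=\int_{[-1,1]^2}\tfrac12\Big[\widetilde{\mathbf Q}^\dagger\mathbf A_x\widetilde{\mathbf Q}\Big]\Big|_{x=-1}^{x=1}\,dy\,dz\le 0 .$$
   Context: The unknown is $\widetilde{\mathbf Q}=(\widetilde{\mathbf v},\widetilde{\boldsymbol\sigma})$ with values in $\mathbb C^9$: velocity $\widetilde{\mathbf v}=(\widetilde v_x,\widetilde v_y,\widetilde v_z)$ and stress $\widetilde{\boldsymbol\sigma}=(\sigma_{xx},\sigma_{yy},\sigma_{zz},\sigma_{xy},\sigma_{xz},\sigma_{yz})$. It is the Laplace transform in time (dual variable $s$) of the solution of the perfectly matched layer (PML) system for linear elastodynamics with zero initial data. In the strip problem, data and solution vary only with $x$ (but live on the 3D domain $\Omega$). Solutions are understood to be sufficiently regular (e.g. $H^1$ in $x$) between discontinuities of $d_x$, satisfying the equation there. $\widetilde{\mathbf F}_Q,\widetilde{\mathbf F}_{w_x}$ are given (Laplace-transformed) source terms in $L^2(\Omega)$. $\mathbf A_x=\begin{pmatrix}\mathbf 0_3&\mathbf a_x\\ \mathbf a_x^T&\mathbf 0_6\end{pmatrix}$, $\mathbf a_x=\begin{pmatrix}1&0&0&0&0&0\\0&0&0&1&0&0\\0&0&0&0&1&0\end{pmatrix}$. $\mathbf P=\mathrm{diag}(\rho^{-1}\mathbf 1_3,\mathbf C)$ is symmetric positive definite and may depend on position, with density $\rho>0$ and symmetric positive definite elastic stiffness matrix $\mathbf C\in\mathbb R^{6\times6}$. The traction on planes $x=\text{const}$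 is $\widetilde{\mathbf T}=\mathbf a_x\widetilde{\boldsymbol\sigma}$, with components $\widetilde T_\eta$, $\eta=x,y,z$. The impedances are $Z_\eta=\rho c_\eta>0$, with $c_x=c_p$ and $c_y=c_z=c_s$ (P- and S-wave speeds; in the isotropic case with Lamé parameters $\lambda,\mu$: $c_p=\sqrt{(2\mu+\lambda)/\rho}$, $c_s=\sqrt{\mu/\rho}$). Superscripts $\pm$ denote the one-sided limits on the two sides of an interface, and $\dagger$ is the complex conjugate transpose. The weighted inner product and norm are $(\mathbf Q,\mathbf F)_P=\int_\Omega\frac12\mathbf Q^\dagger\mathbf P^{-1}\mathbf F\,dx\,dy\,dz$ and $\|\mathbf Q\|_P^2=(\mathbf Q,\mathbf Q)_P$.
   Formalization: The printed estimate with the full boundary term BT is false (e.g. d=0, s=1, P=1, v_x=cosh(x/2), σ_xx=−sinh(x/2), γ=1/e); the estimate is proved with ½·BT in its place, BT itself and BT ≤ 0 being unchanged, and finiteness of ‖F‖_P is assumed. *)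

theory Defs
  imports "HOL-Analysis.Analysis"
begin

section \<open>States, coefficient matrices and the domain\<close>

text \<open>
  A state consists of the velocity (components \<open>Inl i\<close>, with \<open>i = 1, 2, 3\<close> standing for
  x, y, z) and of the stress (components \<open>Inr j\<close>, with \<open>j = 1, ..., 6\<close> standing for
  xx, yy, zz, xy, xz, yz).
\<close>

type_synonym state = "complex ^ (3 + 6)"

definition velocity :: "state \<Rightarrow> complex ^ 3" where
  "velocity q = (\<chi> i. q $ Inl i)"

definition stress :: "state \<Rightarrow> complex ^ 6" where
  "stress q = (\<chi> j. q $ Inr j)"

definition block_matrix ::
  "'a ^ 'm ^ 'm \<Rightarrow> 'a ^ 'n ^ 'm \<Rightarrow> 'a ^ 'm ^ 'n \<Rightarrow> 'a ^ 'n ^ 'n \<Rightarrow> 'a ^ ('m + 'n) ^ ('m + 'n)" where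
  "block_matrix A B C D = (\<chi> i j. case i of
      Inl k \<Rightarrow> (case j of Inl l \<Rightarrow> A $ k $ l | Inr l \<Rightarrow> B $ k $ l)
    | Inr k \<Rightarrow> (case j of Inl l \<Rightarrow> C $ k $ l | Inr l \<Rightarrow> D $ k $ l))"

definition a_x :: "complex ^ 6 ^ 3" where
  "a_x = (\<chi> i j. if i = 1 \<and> j = 1 \<or> i = 2 \<and> j = 4 \<or> i = 3 \<and> j = 5 then 1 else 0)"

definition A_x :: "complex ^ (3 + 6) ^ (3 + 6)" where
  "A_x = block_matrix 0 a_x (transpose a_x) 0"

definition traction :: "state \<Rightarrow> complex ^ 3" where
  "traction q = a_x *v stress q"

definition P_mat :: "(real ^ 3 \<Rightarrow> real) \<Rightarrow> (real ^ 3 \<Rightarrow> real ^ 6 ^ 6) \<Rightarrow> real ^ 3 \<Rightarrow> real ^ (3 + 6) ^ (3 + 6)" where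
  "P_mat \<rho> C p = block_matrix (mat (1 / \<rho> p)) 0 0 (C p)"

definition sym_pos_def :: "real ^ 'n ^ 'n \<Rightarrow> bool" where
  "sym_pos_def M \<longleftrightarrow> transpose M = M \<and> (\<forall>x. x \<noteq> 0 \<longrightarrow> x \<bullet> (M *v x) > 0)"

definition Omega :: "(real ^ 3) set" where
  "Omega = cbox (vec (-1)) (vec 1)"

text \<open>Wave speeds are \<open>c\<^sub>p\<close> in the normal direction and \<open>c\<^sub>s\<close> in the two tangential ones.\<close>

definition impedance ::
  "(real ^ 3 \<Rightarrow> real) \<Rightarrow> (real ^ 3 \<Rightarrow> real) \<Rightarrow> (real ^ 3 \<Rightarrow> real) \<Rightarrow> 3 \<Rightarrow> real ^ 3 \<Rightarrow> real" where
  "impedance \<rho> cp cs \<eta> p = \<rho> p * (if \<eta> = 1 then cp p else cs p)"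

text \<open>A function of \<open>x\<close> alone, regarded as a field on three-dimensional space.\<close>

abbreviation strip :: "(real \<Rightarrow> 'a) \<Rightarrow> real ^ 3 \<Rightarrow> 'a" where
  "strip f \<equiv> (\<lambda>p. f (p $ 1))"


section \<open>Inner product, norm and boundary term\<close>

definition cmat :: "real ^ 'n ^ 'm \<Rightarrow> complex ^ 'n ^ 'm" where
  "cmat M = map_matrix complex_of_real M"

text \<open>The product of the conjugate transpose of \<open>u\<close> with \<open>w\<close>; the library inner product on
  \<open>complex ^ 'n\<close> is only its real part.\<close>

definition hdot :: "complex ^ 'n \<Rightarrow> complex ^ 'n \<Rightarrow> complex" where
  "hdot u w = (\<Sum>i\<in>UNIV. cnj (u $ i) * w $ i)"

definition P_density ::
  "(real ^ 3 \<Rightarrow> real ^ (3 + 6) ^ (3 + 6)) \<Rightarrow> (real ^ 3 \<Rightarrow> state) \<Rightarrow> (real ^ 3 \<Rightarrow> state) \<Rightarrow> real ^ 3 \<Rightarrow> complex" where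
  "P_density P U W p = 1 / 2 * hdot (U p) (cmat (matrix_inv (P p)) *v W p)"

definition P_inner ::
  "(real ^ 3 \<Rightarrow> real ^ (3 + 6) ^ (3 + 6)) \<Rightarrow> (real ^ 3 \<Rightarrow> state) \<Rightarrow> (real ^ 3 \<Rightarrow> state) \<Rightarrow> complex" where
  "P_inner P U W = (LINT p|lebesgue_on Omega. P_density P U W p)"

text \<open>\<open>P_inner P U U\<close> is real and nonnegative when \<open>P\<close> is symmetric positive definite.\<close>

definition P_norm ::
  "(real ^ 3 \<Rightarrow> real ^ (3 + 6) ^ (3 + 6)) \<Rightarrow> (real ^ 3 \<Rightarrow> state) \<Rightarrow> real" where
  "P_norm P U = sqrt (Re (P_inner P U U))"

text \<open>The Bochner integral of a non-integrable function is 0, so that \<open>P_norm\<close> is meaningful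
  only for fields of finite norm.\<close>

definition finite_P_norm ::
  "(real ^ 3 \<Rightarrow> real ^ (3 + 6) ^ (3 + 6)) \<Rightarrow> (real ^ 3 \<Rightarrow> state) \<Rightarrow> bool" where
  "finite_P_norm P U \<longleftrightarrow> integrable (lebesgue_on Omega) (P_density P U U)"

text \<open>
  Taking the real part below loses nothing, since \<open>A_x\<close> is real and symmetric. As
  \<open>d/dx hdot q (A_x *v q) = 2 * Re (hdot q (A_x *v q'))\<close>, the real part of
  \<open>1/2 * hdot q (A_x *v q')\<close> is the derivative of \<open>1/4 * hdot q (A_x *v q)\<close>: integrating by
  parts in the energy identity produces exactly one half of \<open>boundary_term\<close>. The energy
  estimate is false with \<open>boundary_term\<close> in full: with \<open>d = 0\<close>, \<open>s = 1\<close>, unit density and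
  P-wave speed, and \<open>\<gamma> = exp (-1)\<close>, take \<open>v\<^sub>x = cosh (x/2)\<close>, \<open>\<sigma>\<^sub>x\<^sub>x = - sinh (x/2)\<close>, the
  other components 0, and the source \<open>F = 3/2 * Q\<close>.
\<close>

definition boundary_term :: "(real \<Rightarrow> state) \<Rightarrow> real" where
  "boundary_term Q =
    (LINT yz|lebesgue_on (cbox (vec (-1)) (vec 1) :: (real ^ 2) set).
       1 / 2 * (Re (hdot (Q 1) (A_x *v Q 1)) - Re (hdot (Q (-1)) (A_x *v Q (-1)))))"


section \<open>Damping profiles and function spaces\<close>

definition piecewise_constant_on :: "real \<Rightarrow> real \<Rightarrow> (real \<Rightarrow> 'a) \<Rightarrow> bool" where
  "piecewise_constant_on l r f \<longleftrightarrow>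
    (\<exists>D. finite D \<and> (\<forall>x y. l \<le> x \<and> x \<le> y \<and> y \<le> r \<and> {x..y} \<inter> D = {} \<longrightarrow> f x = f y))"

definition jumps :: "(real \<Rightarrow> real) \<Rightarrow> real set" where
  "jumps d = {x \<in> {-1<..<1}. \<not> isCont d x}"

definition square_integrable_on :: "('a::euclidean_space \<Rightarrow> 'b::euclidean_space) \<Rightarrow> 'a set \<Rightarrow> bool" where
  "square_integrable_on f S \<longleftrightarrow>
    f \<in> borel_measurable (lebesgue_on S) \<and> integrable (lebesgue_on S) (\<lambda>x. (norm (f x))\<^sup>2)"

text \<open>
  \<open>Q\<close> is the absolutely continuous representative of a function that is \<open>H\<^sup>1\<close> on each component
  of \<open>[-1, 1]\<close> without \<open>J\<close>, and \<open>Q'\<close> is its weak derivative. The endpoints are included, so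
  that \<open>Q (-1)\<close> and \<open>Q 1\<close> are the boundary traces; the values of \<open>Q\<close> on \<open>J\<close> are arbitrary.
\<close>

definition piecewise_H1 :: "real set \<Rightarrow> (real \<Rightarrow> state) \<Rightarrow> (real \<Rightarrow> state) \<Rightarrow> bool" where
  "piecewise_H1 J Q Q' \<longleftrightarrow>
    square_integrable_on Q' {-1..1} \<and>
    (\<forall>x y. x \<le> y \<and> {x..y} \<subseteq> {-1..1} - J \<longrightarrow> (LINT t|lebesgue_on {x..y}. Q' t) = Q y - Q x)"


section \<open>The strip problem in Laplace space\<close>

definition S_x :: "(real \<Rightarrow> real) \<Rightarrow> (real \<Rightarrow> real) \<Rightarrow> complex \<Rightarrow> real \<Rightarrow> complex" where
  "S_x d \<alpha> s x = 1 + of_real (d x) / (s + of_real (\<alpha> x))"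

definition source ::
  "(real ^ 3 \<Rightarrow> real ^ (3 + 6) ^ (3 + 6)) \<Rightarrow> (real \<Rightarrow> real) \<Rightarrow> (real \<Rightarrow> real) \<Rightarrow> complex \<Rightarrow>
   (real \<Rightarrow> state) \<Rightarrow> (real \<Rightarrow> state) \<Rightarrow> real ^ 3 \<Rightarrow> state" where
  "source P d \<alpha> s FQ Fw p =
    cmat (P p) *v (S_x d \<alpha> s (p $ 1) *s FQ (p $ 1)
                   - (of_real (d (p $ 1)) / (s + of_real (\<alpha> (p $ 1)))) *s Fw (p $ 1))"

definition strip_equation ::
  "(real ^ 3 \<Rightarrow> real ^ (3 + 6) ^ (3 + 6)) \<Rightarrow> (real \<Rightarrow> real) \<Rightarrow> (real \<Rightarrow> real) \<Rightarrow> complex \<Rightarrow>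
   (real \<Rightarrow> state) \<Rightarrow> (real \<Rightarrow> state) \<Rightarrow> (real ^ 3 \<Rightarrow> state) \<Rightarrow> bool" where
  "strip_equation P d \<alpha> s Q Q' F \<longleftrightarrow>
    (AE p in lebesgue_on Omega.
       (s * S_x d \<alpha> s (p $ 1)) *s (cmat (matrix_inv (P p)) *v Q (p $ 1))
       = A_x *v Q' (p $ 1) + cmat (matrix_inv (P p)) *v F p)"

text \<open>\<open>Z \<eta> p\<close> is the impedance at the point \<open>p\<close> of the boundary face.\<close>

definition boundary_conditions ::
  "(3 \<Rightarrow> real ^ 3 \<Rightarrow> real) \<Rightarrow> (3 \<Rightarrow> real) \<Rightarrow> (real \<Rightarrow> state) \<Rightarrow> bool" where
  "boundary_conditions Z \<gamma> Q \<longleftrightarrow>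
    (\<forall>\<eta>. \<forall>y\<in>{-1..1}. \<forall>z\<in>{-1..1}.
       of_real (Z \<eta> (vector [-1, y, z]) / 2 * (1 - \<gamma> \<eta>)) * velocity (Q (-1)) $ \<eta>
         - of_real ((1 + \<gamma> \<eta>) / 2) * traction (Q (-1)) $ \<eta> = 0 \<and>
       of_real (Z \<eta> (vector [1, y, z]) / 2 * (1 - \<gamma> \<eta>)) * velocity (Q 1) $ \<eta>
         + of_real ((1 + \<gamma> \<eta>) / 2) * traction (Q 1) $ \<eta> = 0)"

definition interface_conditions :: "real set \<Rightarrow> (real \<Rightarrow> state) \<Rightarrow> bool" where
  "interface_conditions J Q \<longleftrightarrow>
    (\<forall>x\<in>J. traction (Lim (at_right x) Q) = traction (Lim (at_left x) Q) \<and>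
           velocity (Lim (at_right x) Q) - velocity (Lim (at_left x) Q) = 0)"

end

theory Submission
  imports Defs
begin

text \<open>
  Write \<open>M\<close> for the inverse of \<open>P\<close>, \<open>r\<close> for the real part of \<open>s * S_x\<close>, and \<open>\<bullet>\<close> for the real inner
  product, which is the real part of \<open>hdot\<close>. Pairing the equation with \<open>Q\<close> gives, almost everywhere,
  the energy balance \<open>r * (Q \<bullet> M Q) = Q \<bullet> A_x Q' + Q \<bullet> M F\<close>: the matrix \<open>M\<close> is real and symmetric, so that
  \<open>hdot Q (M Q)\<close> is real and only the real part of the complex factor \<open>s * S_x\<close> survives. Half the
  integral of the left side over the cube is the squared norm on the left of the estimate. Half the
  integral of \<open>Q \<bullet> M F\<close> is at most the product of the two norms, by the Cauchy-Schwarz inequality.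

  The flux term is half of a derivative, as \<open>A_x\<close> is symmetric. The product rule cannot be applied to
  \<open>Q\<close> itself: its components outside the range of \<open>A_x\<close> may jump at the interfaces. The interface
  conditions say exactly that \<open>R = A_x Q\<close> does not jump, so that \<open>R\<close> is absolutely continuous on the
  whole interval, and \<open>A_x\<^sup>3 = A_x\<close> gives \<open>Q \<bullet> A_x Q' = R \<bullet> A_x R'\<close> and \<open>Q \<bullet> A_x Q = R \<bullet> A_x R\<close>. The
  product rule for \<open>R\<close> (\<open>absolutely_continuous_form\<close>) therefore evaluates the flux as half the
  difference of \<open>Q \<bullet> A_x Q\<close> at the two ends (\<open>integral_flux\<close>). A function of \<open>x\<close> has four times its
  integral over the interval as its integral over the cube (\<open>integral_strip\<close>), and this produces one
  half of \<open>boundary_term Q\<close>.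

  The integrals have to be known to converge, since \<open>M\<close> is not assumed to be bounded. Young's
  inequality, with half of the lower bound \<open>a\<close> for \<open>r\<close> absorbed on the left of the balance, dominates
  \<open>Q \<bullet> M Q\<close> by the flux density and \<open>F \<bullet> M F\<close>, which are integrable. Measurability of \<open>Q \<bullet> M Q\<close> also
  comes from the balance, after division by \<open>r\<close>.

  For the sign of the boundary term, \<open>Q \<bullet> A_x Q\<close> is twice the power \<open>v \<bullet> T\<close>, and each boundary
  condition makes \<open>v\<close> and \<open>T\<close> parallel componentwise, with \<open>v \<bullet> T\<close> nonpositive at \<open>x = 1\<close> and nonnegative
  at \<open>x = -1\<close> (\<open>boundary_term_nonpos\<close>).
\<close>


section \<open>The flux matrix\<close>

lemma sum_blocks:
  "(\<Sum>i\<in>(UNIV :: ('m::finite + 'n::finite) set). f i) =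
    (\<Sum>i\<in>UNIV. f (Inl i)) + (\<Sum>j\<in>UNIV. f (Inr j))"
  using sum.Plus[of "UNIV :: 'm set" "UNIV :: 'n set" f] by (simp add: comp_def)

lemma block_matrix_mult:
  fixes A :: "'a::semiring_1 ^ 'm ^ 'm" and D :: "'a ^ 'n ^ 'n"
  shows "(block_matrix A B C D *v q) $ Inl i = (A *v (\<chi> i. q $ Inl i)) $ i + (B *v (\<chi> j. q $ Inr j)) $ i"
    and "(block_matrix A B C D *v q) $ Inr j = (C *v (\<chi> i. q $ Inl i)) $ j + (D *v (\<chi> j. q $ Inr j)) $ j"
  by (simp_all add: matrix_vector_mult_def block_matrix_def sum_blocks)

lemma A_x_mult: "(A_x *v q) $ Inl i = traction q $ i"
  "(A_x *v q) $ Inr j = (transpose a_x *v velocity q) $ j"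
  by (simp_all add: A_x_def block_matrix_mult traction_def stress_def velocity_def)

text \<open>
  The rows of \<open>a_x\<close> are distinct unit vectors, hence orthonormal.
\<close>

lemma a_x_transpose_cancel: "a_x *v (transpose a_x *v v) = v"
proof -
  have a: "(a_x *v w) $ 1 = w $ 1" "(a_x *v w) $ 2 = w $ 4" "(a_x *v w) $ 3 = w $ 5" for w
    unfolding a_x_def matrix_vector_mult_def
    by (simp_all add: if_distrib[of "\<lambda>x. x * _"] cong: if_cong)
  have t: "(transpose a_x *v v) $ 1 = v $ 1" "(transpose a_x *v v) $ 4 = v $ 2"
     "(transpose a_x *v v) $ 5 = v $ 3"
    by (simp_all add: transpose_def a_x_def matrix_vector_mult_def sum_3 del: transpose_matrix_vector)
  show ?thesis by (simp add: vec_eq_iff forall_3 a t del: transpose_matrix_vector)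
qed

text \<open>
  \<open>A_x\<close> exchanges the velocity with the traction and forgets the other stresses; this relation lets
  the flux be expressed through \<open>A_x *v q\<close> alone.
\<close>

lemma A_x_cube: "A_x *v (A_x *v (A_x *v q)) = A_x *v q"
proof -
  have v: "velocity (A_x *v q) = traction q" for q
    by (simp add: velocity_def A_x_mult vec_eq_iff)
  have t: "traction (A_x *v q) = velocity q" for q
    by (simp add: traction_def stress_def A_x_mult a_x_transpose_cancel vec_lambda_eta del: transpose_matrix_vector)
  show ?thesis
    unfolding vec_eq_iff
  proof
    fix i :: "3 + 6"
    show "(A_x *v (A_x *v (A_x *v q))) $ i = (A_x *v q) $ i"
      by (cases i) (simp_all add: A_x_mult v t)
  qed
qed

text \<open>
  The adjoint for the real inner product on complex vectors is the conjugate transpose, which is the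
  transpose when the entries are real.
\<close>

lemma inner_real_matrix:
  fixes A :: "complex ^ 'n ^ 'm"
  assumes "\<And>i j. A $ i $ j \<in> \<real>"
  shows "x \<bullet> (A *v y) = (transpose A *v x) \<bullet> y"
proof -
  have *: "x $ i \<bullet> (A $ i $ j * y $ j) = (A $ i $ j * x $ i) \<bullet> y $ j" for i j
    using assms[of i j] by (auto elim!: Reals_cases simp: inner_complex_def algebra_simps)
  have "x \<bullet> (A *v y) = (\<Sum>i\<in>UNIV. \<Sum>j\<in>UNIV. x $ i \<bullet> (A $ i $ j * y $ j))"
    by (simp add: inner_vec_def matrix_vector_mult_def inner_sum_right)
  also have "\<dots> = (\<Sum>j\<in>UNIV. \<Sum>i\<in>UNIV. x $ i \<bullet> (A $ i $ j * y $ j))"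
    by (rule sum.swap)
  also have "\<dots> = (transpose A *v x) \<bullet> y"
    by (simp add: * inner_vec_def matrix_vector_mult_def inner_sum_left transpose_def)
  finally show ?thesis .
qed

lemma a_x_real: "a_x $ i $ j \<in> \<real>" by (simp add: a_x_def)

lemma A_x_real: "A_x $ i $ j \<in> \<real>"
  by (cases i; cases j) (simp_all add: A_x_def block_matrix_def transpose_def a_x_real)

lemma transpose_A_x: "transpose A_x = A_x"
  unfolding vec_eq_iff
proof (intro allI)
  fix i j :: "3 + 6"
  show "transpose A_x $ i $ j = A_x $ i $ j"
    by (cases i; cases j) (simp_all add: A_x_def block_matrix_def transpose_def)
qed

lemma A_x_self_adjoint: "u \<bullet> (A_x *v w) = (A_x *v u) \<bullet> w"
  using inner_real_matrix[of A_x u w] by (simp add: A_x_real transpose_A_x)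

lemma A_x_form: "q \<bullet> (A_x *v q) = 2 * (velocity q \<bullet> traction q)"
proof -
  have "q \<bullet> (A_x *v q) = (\<Sum>i\<in>UNIV. q $ Inl i \<bullet> traction q $ i) + (\<Sum>j\<in>UNIV. q $ Inr j \<bullet> (transpose a_x *v velocity q) $ j)"
    by (simp add: inner_vec_def sum_blocks A_x_mult)
  also have "\<dots> = velocity q \<bullet> traction q + stress q \<bullet> (transpose a_x *v velocity q)"
    by (simp add: inner_vec_def velocity_def stress_def)
  also have "stress q \<bullet> (transpose a_x *v velocity q) = traction q \<bullet> velocity q"
    by (subst inner_real_matrix) (simp_all add: transpose_def a_x_real traction_def)
  finally show ?thesis by (simp add: inner_commute)
qed

lemma Re_hdot: "Re (hdot u w) = u \<bullet> w"
  by (simp add: hdot_def inner_vec_def inner_complex_def)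

text \<open>
  The interface conditions control exactly the part of the state that \<open>A_x\<close> sees.
\<close>

lemma A_x_mult_cong:
  assumes "traction p = traction q" "velocity p = velocity q"
  shows "A_x *v p = A_x *v q"
  unfolding vec_eq_iff
proof
  fix i :: "3 + 6"
  show "(A_x *v p) $ i = (A_x *v q) $ i"
    using assms by (cases i) (simp_all add: A_x_mult)
qed

section \<open>Boundary flux and the sign of the damping\<close>

text \<open>
  For \<open>g > -1\<close> the condition reads \<open>T = - k v\<close> with \<open>k \<ge> 0\<close>; for \<open>g = -1\<close> it forces \<open>v = 0\<close>. The
  condition at the other end of the interval is the same one for \<open>- T\<close>.
\<close>

lemma impedance_condition_sign:
  fixes v T :: complex
  assumes "Z > 0" "\<bar>g\<bar> \<le> 1"
    and "of_real (Z / 2 * (1 - g)) * v + of_real ((1 + g) / 2) * T = 0"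
  shows "v \<bullet> T \<le> 0"
proof -
  have "(Z / 2 * (1 - g)) *\<^sub>R v + ((1 + g) / 2) *\<^sub>R T = 0"
    using assms(3) by (simp only: scaleR_conv_of_real)
  then have *: "((1 + g) / 2) *\<^sub>R T = - ((Z / 2 * (1 - g)) *\<^sub>R v)"
    by (metis eq_neg_iff_add_eq_0 add.commute)
  show ?thesis
  proof (cases "g = -1")
    case True
    then show ?thesis using * assms(1) by simp
  next
    case False
    then have g: "1 + g > 0" using assms(2) by linarith
    have "((1 + g) / 2) * (v \<bullet> T) = v \<bullet> (((1 + g) / 2) *\<^sub>R T)" by simp
    also have "\<dots> = - (Z / 2 * (1 - g) * (v \<bullet> v))" unfolding * by simp
    also have "\<dots> \<le> 0" using assms(1,2) by simp
    finally show ?thesis using g by (simp add: mult_le_0_iff)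
  qed
qed

lemma boundary_term_eq: "boundary_term Q = 2 * (Q 1 \<bullet> (A_x *v Q 1) - Q (-1) \<bullet> (A_x *v Q (-1)))"
proof -
  have "measure lebesgue (cbox (vec (-1)) (vec 1) :: (real^2) set) = 4"
  proof -
    have "(vec 1 :: real^2) \<in> cbox (vec (-1)) (vec 1)"
      by (auto simp: mem_box_cart)
    then have "cbox (vec (-1)) (vec 1) \<noteq> ({} :: (real^2) set)" by blast
    from content_cbox_cart[OF this] show ?thesis unfolding UNIV_2 by simp
  qed
  then show ?thesis
    by (simp add: boundary_term_def Re_hdot measure_restrict_space)
qed

lemma boundary_term_nonpos:
  assumes density: "\<And>p. p \<in> Omega \<Longrightarrow> \<rho> p > 0"
    and wave_speeds: "\<And>p. p \<in> Omega \<Longrightarrow> cp p > 0" "\<And>p. p \<in> Omega \<Longrightarrow> cs p > 0"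
    and reflection: "\<And>\<eta>. \<bar>\<gamma> \<eta>\<bar> \<le> 1"
    and boundary: "boundary_conditions (impedance \<rho> cp cs) \<gamma> Q"
  shows "boundary_term Q \<le> 0"
proof -
  \<comment> \<open>The state does not depend on the position on the face, so that one point of each face suffices.\<close>
  have Om: "vector [-1, 0, 0] \<in> Omega" "vector [1, 0, 0] \<in> Omega"
    by (auto simp: Omega_def mem_box_cart forall_3)
  have Z: "impedance \<rho> cp cs \<eta> p > 0" if "p \<in> Omega" for \<eta> p
    using density[OF that] wave_speeds[OF that] by (simp add: impedance_def)
  have bc: "of_real (impedance \<rho> cp cs \<eta> (vector [-1, 0, 0]) / 2 * (1 - \<gamma> \<eta>)) * velocity (Q (-1)) $ \<eta>
         - of_real ((1 + \<gamma> \<eta>) / 2) * traction (Q (-1)) $ \<eta> = 0"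
     "of_real (impedance \<rho> cp cs \<eta> (vector [1, 0, 0]) / 2 * (1 - \<gamma> \<eta>)) * velocity (Q 1) $ \<eta>
         + of_real ((1 + \<gamma> \<eta>) / 2) * traction (Q 1) $ \<eta> = 0" for \<eta>
  proof -
    have z: "(0::real) \<in> {-1..1}" by simp
    from boundary[unfolded boundary_conditions_def, rule_format, OF z z, of \<eta>]
    show "of_real (impedance \<rho> cp cs \<eta> (vector [-1, 0, 0]) / 2 * (1 - \<gamma> \<eta>)) * velocity (Q (-1)) $ \<eta>
         - of_real ((1 + \<gamma> \<eta>) / 2) * traction (Q (-1)) $ \<eta> = 0"
     "of_real (impedance \<rho> cp cs \<eta> (vector [1, 0, 0]) / 2 * (1 - \<gamma> \<eta>)) * velocity (Q 1) $ \<eta>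
         + of_real ((1 + \<gamma> \<eta>) / 2) * traction (Q 1) $ \<eta> = 0" by blast+
  qed
  have "velocity (Q 1) $ \<eta> \<bullet> traction (Q 1) $ \<eta> \<le> 0" for \<eta>
    by (rule impedance_condition_sign[OF Z[OF Om(2)] reflection bc(2)])
  then have 1: "velocity (Q 1) \<bullet> traction (Q 1) \<le> 0"
    by (simp add: inner_vec_def sum_nonpos)
  have "velocity (Q (-1)) $ \<eta> \<bullet> (- traction (Q (-1)) $ \<eta>) \<le> 0" for \<eta>
    by (rule impedance_condition_sign[OF Z[OF Om(1)] reflection, of \<eta> \<eta>]) (use bc(1)[of \<eta>] in simp)
  then have 2: "velocity (Q (-1)) \<bullet> traction (Q (-1)) \<ge> 0"
    by (simp add: inner_vec_def sum_nonneg)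
  show ?thesis using 1 2 by (simp add: boundary_term_eq A_x_form)
qed

text \<open>
  The damping adds \<open>d * s / (s + \<alpha>)\<close> to \<open>s\<close>, and \<open>s * cnj (s + \<alpha>)\<close> has real part
  \<open>\<bar>s\<bar>\<^sup>2 + \<alpha> * Re s \<ge> 0\<close>.
\<close>

lemma Re_symbol_ge:
  assumes "Re s \<ge> a" "a > 0" "d x \<ge> 0" "\<alpha> x \<ge> 0"
  shows "Re (s * S_x d \<alpha> s x) \<ge> a"
proof -
  have "Re (s * (of_real (d x) / (s + of_real (\<alpha> x)))) \<ge> 0"
  proof -
    have "s * (of_real (d x) / (s + of_real (\<alpha> x))) = of_real (d x) * (s / (s + of_real (\<alpha> x)))"
      by simp
    moreover have "Re (s / (s + of_real (\<alpha> x))) \<ge> 0"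
      using assms by (auto simp: Re_divide intro!: divide_nonneg_nonneg add_nonneg_nonneg mult_nonneg_nonneg)
    moreover have "Re (of_real (d x) * z) = d x * Re z" for z by simp
    ultimately show ?thesis using assms(3) by (metis mult_nonneg_nonneg)
  qed
  then show ?thesis using assms(1) by (simp add: S_x_def distrib_left del: times_divide_eq_right times_complex.sel)
qed

section \<open>The weight matrix and the weighted norm\<close>

lemma sym_pos_def_inverse:
  fixes P :: "real ^ 'n ^ 'n"
  assumes "sym_pos_def P"
  shows "matrix_inv P ** P = mat 1" "transpose (matrix_inv P) = matrix_inv P"
    "x \<bullet> (matrix_inv P *v x) \<ge> 0"
proof -
  have "x = 0" if "P *v x = 0" for x
    using assms that unfolding sym_pos_def_def by (metis inner_zero_right less_irrefl)
  then have inv: "invertible P"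
    by (meson invertible_left_inverse matrix_left_invertible_ker)
  have "P ** matrix_inv P = mat 1 \<and> matrix_inv P ** P = mat 1"
    using inv unfolding invertible_def matrix_inv_def by (rule someI_ex)
  then have l: "matrix_inv P ** P = mat 1" and r: "P ** matrix_inv P = mat 1" by auto
  show "matrix_inv P ** P = mat 1" by (rule l)
  have sym: "transpose P = P" using assms by (simp add: sym_pos_def_def)
  have "transpose (matrix_inv P) ** P = mat 1"
    by (metis r sym matrix_transpose_mul transpose_mat)
  then have "transpose (matrix_inv P) ** P ** matrix_inv P = matrix_inv P" by simp
  then show "transpose (matrix_inv P) = matrix_inv P"
    by (simp add: r flip: matrix_mul_assoc)
  obtain y where y: "matrix_inv P *v x = y" "P *v y = x"
    by (metis r matrix_vector_mul_assoc matrix_vector_mul_lid)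
  have "y \<bullet> (P *v y) \<ge> 0"
    using assms unfolding sym_pos_def_def by (metis inner_zero_left less_imp_le order_refl)
  then have "(P *v y) \<bullet> y \<ge> 0" by (metis inner_commute)
  then show "x \<bullet> (matrix_inv P *v x) \<ge> 0"
    unfolding y .
qed

lemma sym_pos_def_P_mat:
  assumes "\<rho> p > 0" "sym_pos_def (C p)"
  shows "sym_pos_def (P_mat \<rho> C p)"
  unfolding sym_pos_def_def
proof (intro conjI allI impI)
  have tC: "C p $ j $ i = C p $ i $ j" for i j
  proof -
    have "transpose (C p) $ i $ j = C p $ i $ j" using assms(2) by (simp add: sym_pos_def_def)
    then show ?thesis by (simp add: transpose_def)
  qed
  show "transpose (P_mat \<rho> C p) = P_mat \<rho> C p"
    unfolding vec_eq_iff
  proof (intro allI)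
    fix i j :: "3 + 6"
    show "transpose (P_mat \<rho> C p) $ i $ j = P_mat \<rho> C p $ i $ j"
      by (cases i; cases j) (auto simp: P_mat_def block_matrix_def transpose_def mat_def tC)
  qed
  fix x :: "real ^ (3 + 6)" assume "x \<noteq> 0"
  define y z where "y = (\<chi> i. x $ Inl i)" and "z = (\<chi> j. x $ Inr j)"
  have m: "mat (1 / \<rho> p) *v y = (1 / \<rho> p) *\<^sub>R y"
    by (simp add: vec_eq_iff matrix_vector_mult_def mat_def if_distrib[of "\<lambda>x. x * _"] cong: if_cong)
  have "x \<bullet> (P_mat \<rho> C p *v x) = y \<bullet> (mat (1 / \<rho> p) *v y) + z \<bullet> (C p *v z)"
    unfolding inner_vec_def sum_blocks by (simp add: P_mat_def block_matrix_mult y_def z_def)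
  then have e: "x \<bullet> (P_mat \<rho> C p *v x) = (1 / \<rho> p) * (y \<bullet> y) + z \<bullet> (C p *v z)"
    unfolding m by simp
  have "y \<noteq> 0 \<or> z \<noteq> 0"
  proof (rule ccontr)
    assume "\<not> (y \<noteq> 0 \<or> z \<noteq> 0)"
    then have "x $ Inl i = 0" "x $ Inr j = 0" for i j by (auto simp: y_def z_def vec_eq_iff)
    then have "x $ i = 0" for i by (cases i) auto
    then show False using \<open>x \<noteq> 0\<close> by (simp add: vec_eq_iff)
  qed
  moreover have "z \<noteq> 0 \<Longrightarrow> z \<bullet> (C p *v z) > 0" "z \<bullet> (C p *v z) \<ge> 0"
    using assms(2) unfolding sym_pos_def_def by (blast, cases "z = 0") (auto intro: less_imp_le)
  moreover have "y \<noteq> 0 \<Longrightarrow> (1 / \<rho> p) * (y \<bullet> y) > 0" "(1 / \<rho> p) * (y \<bullet> y) \<ge> 0"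
    using assms(1) by auto
  ultimately show "x \<bullet> (P_mat \<rho> C p *v x) > 0" unfolding e by linarith
qed

lemma cmat_self_adjoint:
  assumes "transpose M = M"
  shows "u \<bullet> (cmat M *v w) = (cmat M *v u) \<bullet> w"
proof -
  have "transpose (cmat M) = cmat M"
    using assms by (simp add: cmat_def map_matrix_def transpose_def vec_eq_iff)
  then show ?thesis using inner_real_matrix[of "cmat M" u w] by (simp add: cmat_def map_matrix_def)
qed

lemma cmat_mult: "cmat M *v (cmat N *v w) = cmat (M ** N) *v w"
  by (simp add: cmat_def matrix_vector_mul_assoc)
   (simp add: map_matrix_def matrix_matrix_mult_def)

lemma cmat_mat_1: "cmat (mat 1) = mat 1"
  by (simp add: cmat_def map_matrix_def mat_def vec_eq_iff)

text \<open>
  A real matrix acts separately on real and imaginary parts, which reduces positivity on complex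
  states to positivity on real ones.
\<close>

lemma inner_cmat:
  "u \<bullet> (cmat M *v w) = (\<chi> i. Re (u $ i)) \<bullet> (M *v (\<chi> i. Re (w $ i))) + (\<chi> i. Im (u $ i)) \<bullet> (M *v (\<chi> i. Im (w $ i)))"
  by (simp add: inner_vec_def inner_complex_def cmat_def map_matrix_def matrix_vector_mult_def sum.distrib)

text \<open>
  The form of a Hermitian matrix is real. The imaginary part is the real inner product with the second
  argument rotated by \<open>- \<i>\<close>, and moving the rotation through the self-adjoint matrix changes its sign.
\<close>

lemma hdot_cmat_self:
  assumes "transpose M = M"
  shows "hdot u (cmat M *v u) = of_real (u \<bullet> (cmat M *v u))"
proof -
  have "Im (hdot u (cmat M *v u)) = u \<bullet> (- \<i> *s (cmat M *v u))"
    unfolding Re_hdot[symmetric] by (simp add: hdot_def)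
  also have "- \<i> *s (cmat M *v u) = cmat M *v (- \<i> *s u)"
    by (simp add: vec_eq_iff matrix_vector_mult_def sum_distrib_left sum_negf ac_simps)
  also have "u \<bullet> (cmat M *v (- \<i> *s u)) = (cmat M *v u) \<bullet> (- \<i> *s u)"
    by (rule cmat_self_adjoint[OF assms])
  also have "\<dots> = - Im (hdot u (cmat M *v u))"
    by (simp add: hdot_def inner_vec_def inner_complex_def sum_negf algebra_simps sum.distrib sum_subtractf)
  finally show ?thesis by (simp add: complex_eq_iff Re_hdot)
qed

lemma cmat_form_nonneg:
  assumes "\<And>x. x \<bullet> (M *v x) \<ge> 0"
  shows "u \<bullet> (cmat M *v u) \<ge> 0"
  unfolding inner_cmat using assms by (intro add_nonneg_nonneg)

text \<open>
  Positivity of the form at \<open>t *\<^sub>R u - w\<close>. Varying \<open>t\<close> makes this single inequality serve both as Young's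
  inequality and, after integration, as the Cauchy-Schwarz inequality.
\<close>

lemma cmat_form_bound:
  assumes "transpose M = M" "\<And>x. x \<bullet> (M *v x) \<ge> 0"
  shows "2 * t * (u \<bullet> (cmat M *v w)) \<le> t\<^sup>2 * (u \<bullet> (cmat M *v u)) + w \<bullet> (cmat M *v w)"
proof -
  interpret L: bounded_linear "(*v) (cmat M)" by (rule matrix_vector_mul_bounded_linear)
  have "0 \<le> (t *\<^sub>R u - w) \<bullet> (cmat M *v (t *\<^sub>R u - w))"
    by (rule cmat_form_nonneg) (rule assms(2))
  also have "\<dots> = t\<^sup>2 * (u \<bullet> (cmat M *v u)) - 2 * t * (u \<bullet> (cmat M *v w)) + w \<bullet> (cmat M *v w)"
    using cmat_self_adjoint[OF assms(1), of w u]
    by (simp add: L.diff L.scaleR inner_diff_left inner_diff_right power2_eq_square inner_commute algebra_simps)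
  finally show ?thesis by simp
qed

text \<open>
  The best \<open>t\<close> is \<open>\<beta> / \<alpha>\<close>. For \<open>\<alpha> = 0\<close> the bound is affine in \<open>t\<close>, and \<open>\<beta>\<close> cannot be positive.
\<close>

lemma cauchy_schwarz_from_quadratic:
  fixes \<alpha> \<beta> \<kappa> :: real
  assumes bound: "\<And>t. 2 * t * \<beta> \<le> t\<^sup>2 * \<alpha> + \<kappa>" and "\<alpha> \<ge> 0"
  shows "\<beta> \<le> sqrt \<alpha> * sqrt \<kappa>"
proof (cases "\<alpha> = 0")
  case True
  have "\<beta> \<le> 0"
  proof (rule ccontr)
    assume "\<not> \<beta> \<le> 0"
    then show False using bound[of "(\<kappa> + 1) / (2 * \<beta>)"] True by simp
  qed
  then show ?thesis using True by simp
next
  case False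
  have "2 * (\<beta> / \<alpha>) * \<beta> = 2 * (\<beta>\<^sup>2 / \<alpha>)" "(\<beta> / \<alpha>)\<^sup>2 * \<alpha> = \<beta>\<^sup>2 / \<alpha>"
    using False by (simp_all add: power2_eq_square)
  then have "\<beta>\<^sup>2 / \<alpha> \<le> \<kappa>" using bound[of "\<beta> / \<alpha>"] by linarith
  moreover have "\<alpha> > 0" using False \<open>\<alpha> \<ge> 0\<close> by simp
  ultimately have "\<beta>\<^sup>2 \<le> \<alpha> * \<kappa>" by (simp add: pos_divide_le_eq mult.commute)
  then show ?thesis by (metis real_le_rsqrt real_sqrt_mult)
qed

lemma hdot_scalar: "hdot u (c *s w) = c * hdot u w"
  by (simp add: hdot_def sum_distrib_left ac_simps)

text \<open>
  Symmetry makes the density of \<open>P_inner P U U\<close> real, so that the norm and its finiteness can be treated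
  with real integrals of the form.
\<close>

lemma P_norm_eq:
  assumes "\<And>p. p \<in> Omega \<Longrightarrow> transpose (matrix_inv (P p)) = matrix_inv (P p)"
  shows "P_norm P U = sqrt (1 / 2 * (LINT p|lebesgue_on Omega. U p \<bullet> (cmat (matrix_inv (P p)) *v U p)))"
    and "finite_P_norm P U \<longleftrightarrow>
      integrable (lebesgue_on Omega) (\<lambda>p. U p \<bullet> (cmat (matrix_inv (P p)) *v U p))"
proof -
  have d: "P_density P U U p = complex_of_real (1 / 2 * (U p \<bullet> (cmat (matrix_inv (P p)) *v U p)))"
    if "p \<in> Omega" for p
    using hdot_cmat_self[OF assms[OF that]] by (simp add: P_density_def)
  have "P_inner P U U = (LINT p|lebesgue_on Omega. complex_of_real (1 / 2 * (U p \<bullet> (cmat (matrix_inv (P p)) *v U p))))"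
    unfolding P_inner_def by (rule Bochner_Integration.integral_cong) (simp_all only: d space_lebesgue_on)
  also have "\<dots> = complex_of_real (1 / 2 * (LINT p|lebesgue_on Omega. U p \<bullet> (cmat (matrix_inv (P p)) *v U p)))"
    unfolding integral_complex_of_real by simp
  finally show "P_norm P U = sqrt (1 / 2 * (LINT p|lebesgue_on Omega. U p \<bullet> (cmat (matrix_inv (P p)) *v U p)))"
    unfolding P_norm_def by (simp only: Re_complex_of_real)
  have "finite_P_norm P U \<longleftrightarrow> integrable (lebesgue_on Omega)
      (\<lambda>p. complex_of_real (1 / 2 * (U p \<bullet> (cmat (matrix_inv (P p)) *v U p))))"
    unfolding finite_P_norm_def by (rule Bochner_Integration.integrable_cong) (simp_all only: d space_lebesgue_on)
  also have "\<dots> \<longleftrightarrow> integrable (lebesgue_on Omega) (\<lambda>p. 1 / 2 * (U p \<bullet> (cmat (matrix_inv (P p)) *v U p)))"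
    by (rule complex_of_real_integrable_eq)
  finally show "finite_P_norm P U \<longleftrightarrow>
      integrable (lebesgue_on Omega) (\<lambda>p. U p \<bullet> (cmat (matrix_inv (P p)) *v U p))"
    by (simp only: integrable_mult_left_iff) simp
qed

section \<open>Fields depending on one coordinate\<close>

text \<open>
  Both sides are finite Borel measures in \<open>B\<close>, so that it is enough to compare them on the rays
  \<open>{x<..}\<close>. There the left side is the volume of a half-open box, which lies between an open and a
  closed box of volume \<open>4 * (1 - x)\<close>.
\<close>

lemma emeasure_lborel_slab:
  fixes B :: "real set"
  assumes "B \<in> sets borel"
  shows "emeasure lborel {p \<in> Omega. p $ 1 \<in> B} = 4 * emeasure lborel (B \<inter> {-1..1})"
proof -
  let ?T = "\<lambda>p::real^3. p $ 1"
  define M where "M = distr (restrict_space lborel Omega) borel ?T"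
  define N where "N = distr (scale_measure 4 (restrict_space lborel {-1..1::real})) borel (\<lambda>x. x)"
  have [measurable]: "Omega \<in> sets borel" by (simp add: Omega_def)
  have T [measurable]: "?T \<in> borel_measurable borel"
    by (intro borel_measurable_continuous_onI continuous_intros)
  have T': "?T \<in> measurable (restrict_space lborel Omega) borel"
    by (rule measurable_restrict_space1) simp
  have eM: "emeasure M A = emeasure lborel {p \<in> Omega. p $ 1 \<in> A}" if [measurable]: "A \<in> sets borel" for A
  proof -
    have "emeasure M A = emeasure lborel (?T -` A \<inter> Omega)"
      unfolding M_def using that T'
      by (subst emeasure_distr) (auto simp: space_restrict_space emeasure_restrict_space)
    also have "?T -` A \<inter> Omega = {p \<in> Omega. p $ 1 \<in> A}" by auto
    finally show ?thesis .
  qed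
  have I: "(\<lambda>x::real. x) \<in> measurable (scale_measure 4 (restrict_space lborel {-1..1})) borel"
    by (simp add: measurable_def space_restrict_space space_scale_measure sets_restrict_space) blast
  have eN: "emeasure N A = 4 * emeasure lborel (A \<inter> {-1..1})" if [measurable]: "A \<in> sets borel" for A
    unfolding N_def using that I
    by (subst emeasure_distr)
      (auto simp: space_restrict_space emeasure_restrict_space space_scale_measure)
  have box_eq: "emeasure lborel (cbox (vector [x, -1, -1]) (vec 1) :: (real^3) set) = 4 * ennreal (1 - x)"
    and box_eq': "emeasure lborel (box (vector [x, -1, -1]) (vec 1) :: (real^3) set) = 4 * ennreal (1 - x)"
    if "x \<le> 1" for x
  proof -
    have prod3: "prod f (UNIV :: 3 set) = f 1 * f 2 * f 3" for f :: "3 \<Rightarrow> real"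
      unfolding UNIV_3 by simp
    have 1: "emeasure lborel (cbox (vector [x, -1, -1]) (vec 1) :: (real^3) set) =
      ennreal (measure lborel (cbox (vector [x, -1, -1]) (vec 1) :: (real^3) set))"
      by (rule emeasure_eq_ennreal_measure) (simp add: emeasure_lborel_cbox_eq)
    also have "measure lborel (cbox (vector [x, -1, -1]) (vec 1) :: (real^3) set) = 4 * (1 - x)"
    proof (subst content_cbox_cart)
      have "(vec 1 :: real^3) \<in> cbox (vector [x, -1, -1]) (vec 1)"
        using that by (auto simp: mem_box_cart forall_3)
      then show "cbox (vector [x, -1, -1]) (vec 1) \<noteq> ({} :: (real^3) set)" by auto
    qed (simp add: prod3)
    finally show 2: "emeasure lborel (cbox (vector [x, -1, -1]) (vec 1) :: (real^3) set) = 4 * ennreal (1 - x)"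
      using that ennreal_mult'[of 4 "1 - x"] by simp
    show "emeasure lborel (box (vector [x, -1, -1]) (vec 1) :: (real^3) set) = 4 * ennreal (1 - x)"
      unfolding 2[symmetric] emeasure_lborel_box_eq emeasure_lborel_cbox_eq ..
  qed
  have key: "emeasure lborel {p \<in> Omega. x < p $ 1} = 4 * emeasure lborel ({x<..} \<inter> {-1..1})" for x
  proof -
    consider "x < -1" | "-1 \<le> x" "x \<le> 1" | "1 < x" by linarith
    then show ?thesis
    proof cases
      case 1
      then have "{p \<in> Omega. x < p $ 1} = cbox (vector [-1,-1,-1]) (vec 1)"
        by (auto simp: Omega_def mem_box_cart forall_3)
      moreover have "{x<..} \<inter> {-1..1} = {-1..1}" using 1 by auto
      ultimately show ?thesis using box_eq[of "-1"] by simp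
    next
      case 2
      have [measurable]: "{p \<in> Omega. x < p $ 1} \<in> sets borel"
        unfolding Omega_def by measurable
      have "emeasure lborel {p \<in> Omega. x < p $ 1} = 4 * ennreal (1 - x)"
      proof (rule antisym)
        show "emeasure lborel {p \<in> Omega. x < p $ 1} \<le> 4 * ennreal (1 - x)"
          unfolding box_eq[OF 2(2), symmetric]
          by (rule emeasure_mono) (auto simp: Omega_def mem_box_cart forall_3)
        show "4 * ennreal (1 - x) \<le> emeasure lborel {p \<in> Omega. x < p $ 1}"
          unfolding box_eq'[OF 2(2), symmetric]
          using 2 by (intro emeasure_mono) (auto simp: Omega_def mem_box_cart forall_3 intro: less_imp_le)
      qed
      moreover have "{x<..} \<inter> {-1..1} = {x<..1}" using 2 by auto
      ultimately show ?thesis using 2 by simp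
    next
      case 3
      then have "{p \<in> Omega. x < p $ 1} = {}" "{x<..} \<inter> {-1..1} = {}"
        by (auto simp: Omega_def mem_box_cart forall_3)
      then show ?thesis by (simp only: emeasure_empty mult_zero_right)
    qed
  qed
  have "M = N"
  proof (rule measure_eqI_lessThan)
    fix x :: real
    show "emeasure M {x<..} = emeasure N {x<..}"
      using key[of x] by (simp add: eM eN)
    have "emeasure N {x<..} \<le> 4 * emeasure lborel {-1..1::real}"
      unfolding eN[OF borel_open[OF open_greaterThan]] by (intro mult_left_mono emeasure_mono) auto
    also have "\<dots> < \<infinity>" by (simp add: ennreal_mult_less_top)
    finally show "emeasure M {x<..} < \<infinity>"
      using key[of x] by (simp add: eM eN)
  qed (auto simp: M_def N_def)
  then show ?thesis using eM[OF assms] eN[OF assms] by simp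
qed

text \<open>
  Passage from Borel to Lebesgue sets: a Lebesgue set is a Borel set up to part of a Borel null set, and
  the slab over a null set is null by the Borel case.
\<close>

lemma strip_preimage:
  assumes "B \<in> sets (lebesgue_on {-1..1::real})"
  shows "{p \<in> Omega. p $ 1 \<in> B} \<in> sets (lebesgue_on Omega)"
    and "emeasure (lebesgue_on Omega) {p \<in> Omega. p $ 1 \<in> B} = 4 * emeasure (lebesgue_on {-1..1}) B"
proof -
  let ?V = "\<lambda>B. {p \<in> Omega. p $ 1 \<in> B}"
  have B: "B \<in> sets lebesgue" "B \<subseteq> {-1..1}"
    using assms by (auto simp: sets_restrict_space)
  have V [measurable]: "?V S \<in> sets borel" if [measurable]: "S \<in> sets borel" for S
    unfolding Omega_def by measurable
  obtain S N N' where SN: "B = S \<union> N" "N \<subseteq> N'" "N' \<in> null_sets lborel" "S \<in> sets lborel"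
    by (rule sets_completionE[OF B(1)])
  have "emeasure lborel (?V N') = 0"
    using SN(3) by (subst emeasure_lborel_slab) (auto intro!: null_setsD1 null_set_Int2)
  then have "?V N' \<in> null_sets lborel" using V[of N'] SN(3) by (intro null_setsI) auto
  moreover have "?V N \<subseteq> ?V N'" using SN(2) by auto
  ultimately have VN: "?V N \<in> null_sets lebesgue"
    by (auto simp: null_sets_completion_iff2)
  have N: "N \<in> null_sets lebesgue"
    using SN(2,3) by (auto simp: null_sets_completion_iff2)
  have VB: "?V B = ?V S \<union> ?V N" using SN(1) by auto
  have VS: "?V S \<in> sets lebesgue" using V[of S] SN(4) by (intro sets_completionI_sets) simp
  have meas: "?V B \<in> sets lebesgue" unfolding VB using VN VS by auto
  have Om: "Omega \<in> sets lebesgue" by (simp add: Omega_def)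
  show "?V B \<in> sets (lebesgue_on Omega)"
    using meas Om by (auto simp: sets_restrict_space_iff)
  have "emeasure (lebesgue_on Omega) (?V B) = emeasure lebesgue (?V B)"
    using Om by (intro emeasure_restrict_space) auto
  also have "\<dots> = emeasure lebesgue (?V S)"
    unfolding VB using VN VS by (rule emeasure_Un_null_set[rotated])
  also have "\<dots> = emeasure lborel (?V S)" using V[of S] SN(4) by simp
  also have "\<dots> = 4 * emeasure lborel (S \<inter> {-1..1})"
    using SN(4) by (intro emeasure_lborel_slab) simp
  also have "S \<inter> {-1..1} = S" using SN(1) B by auto
  also have "emeasure lborel S = emeasure lebesgue S" using SN(4) by simp
  also have "\<dots> = emeasure lebesgue B"
    unfolding SN(1) using SN(4) N by (intro emeasure_Un_null_set[symmetric]) auto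
  also have "\<dots> = emeasure (lebesgue_on {-1..1}) B"
    using B by (intro emeasure_restrict_space[symmetric]) auto
  finally show "emeasure (lebesgue_on Omega) (?V B) = 4 * emeasure (lebesgue_on {-1..1}) B" .
qed

lemma measurable_first_coordinate:
  "(\<lambda>p. p $ 1) \<in> measurable (lebesgue_on Omega) (lebesgue_on {-1..1})"
proof (rule measurableI)
  fix B assume "B \<in> sets (lebesgue_on {-1..1::real})"
  then have "{p \<in> Omega. p $ 1 \<in> B} \<in> sets (lebesgue_on Omega)" by (rule strip_preimage(1))
  moreover have "(\<lambda>p. p $ 1) -` B \<inter> space (lebesgue_on Omega) = {p \<in> Omega. p $ 1 \<in> B}" by auto
  ultimately show "(\<lambda>p. p $ 1) -` B \<inter> space (lebesgue_on Omega) \<in> sets (lebesgue_on Omega)"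
    by (simp only:)
next
  fix p assume "p \<in> space (lebesgue_on Omega)"
  then have "\<forall>i. -1 \<le> p $ i \<and> p $ i \<le> 1" by (simp add: Omega_def mem_box_cart)
  then show "p $ 1 \<in> space (lebesgue_on {-1..1})" by simp
qed

lemma borel_measurable_strip:
  "f \<in> borel_measurable (lebesgue_on {-1..1}) \<Longrightarrow> strip f \<in> borel_measurable (lebesgue_on Omega)"
  by (rule measurable_compose[OF measurable_first_coordinate])

lemma distr_first_coordinate:
  "distr (lebesgue_on Omega) (lebesgue_on {-1..1}) (\<lambda>p. p $ 1) = scale_measure 4 (lebesgue_on {-1..1})"
proof (rule measure_eqI)
  fix B assume "B \<in> sets (distr (lebesgue_on Omega) (lebesgue_on {-1..1::real}) (\<lambda>p. p $ 1))"
  then have B: "B \<in> sets (lebesgue_on {-1..1})" by simp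
  have "(\<lambda>p. p $ 1) -` B \<inter> space (lebesgue_on Omega) = {p \<in> Omega. p $ 1 \<in> B}" by auto
  with strip_preimage(2)[OF B] show "emeasure (distr (lebesgue_on Omega) (lebesgue_on {-1..1}) (\<lambda>p. p $ 1)) B =
      emeasure (scale_measure 4 (lebesgue_on {-1..1})) B"
    by (simp only: emeasure_distr[OF measurable_first_coordinate B] emeasure_scale_measure)
qed simp

text \<open>
  Projecting the cube to its first coordinate maps Lebesgue measure to four times Lebesgue measure on
  the interval, four being the area of the cross-section.
\<close>

lemma integral_strip:
  fixes f :: "real \<Rightarrow> real"
  assumes f: "integrable (lebesgue_on {-1..1}) f"
  shows "integrable (lebesgue_on Omega) (strip f)"
    and "(LINT p|lebesgue_on Omega. f (p $ 1)) = 4 * (LINT x|lebesgue_on {-1..1}. f x)"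
proof -
  have s: "scale_measure 4 (lebesgue_on {-1..1::real}) = density (lebesgue_on {-1..1}) (\<lambda>_. ennreal 4)"
    by (rule measure_eqI) (auto simp: emeasure_density nn_integral_cmult)
  have m: "f \<in> borel_measurable (lebesgue_on {-1..1})" using f by auto
  have "integrable (scale_measure 4 (lebesgue_on {-1..1::real})) f"
    unfolding s using m f by (subst integrable_density) auto
  then show "integrable (lebesgue_on Omega) (strip f)"
    unfolding distr_first_coordinate[symmetric]
    by (rule integrable_distr[OF measurable_first_coordinate])
  have "(LINT p|lebesgue_on Omega. f (p $ 1)) = (LINT x|scale_measure 4 (lebesgue_on {-1..1::real}). f x)"
    unfolding distr_first_coordinate[symmetric]
    by (rule integral_distr[OF measurable_first_coordinate m, symmetric])
  also have "\<dots> = 4 * (LINT x|lebesgue_on {-1..1}. f x)"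
    unfolding s using m f by (subst integral_density) auto
  finally show "(LINT p|lebesgue_on Omega. f (p $ 1)) = 4 * (LINT x|lebesgue_on {-1..1}. f x)" .
qed

lemma borel_measurable_scalar_vec [measurable (raw)]:
  fixes v :: "'b \<Rightarrow> complex ^ 'n"
  assumes "c \<in> borel_measurable M" "v \<in> borel_measurable M"
  shows "(\<lambda>x. c x *s v x) \<in> borel_measurable M"
  by (rule borel_measurable_continuous_Pair[OF assms])
    (auto simp: vector_scalar_mult_def intro!: continuous_intros)

text \<open>
  Lebesgue measure is complete, so that a function known almost everywhere, here through the
  differential equation, inherits measurability.
\<close>

lemma borel_measurable_lebesgue_on_AE:
  fixes f g :: "'a::euclidean_space \<Rightarrow> 'b::euclidean_space"
  assumes f: "f \<in> borel_measurable (lebesgue_on S)" and S: "S \<in> sets lebesgue"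
    and ae: "AE x in lebesgue_on S. f x = g x"
  shows "g \<in> borel_measurable (lebesgue_on S)"
proof (rule borel_measurable_if_D)
  show "(\<lambda>x. if x \<in> S then g x else 0) \<in> borel_measurable lebesgue"
  proof (rule borel_measurable_AE)
    show "(\<lambda>x. if x \<in> S then f x else 0) \<in> borel_measurable lebesgue"
      by (rule borel_measurable_if_I[OF f S])
    have "AE x in lebesgue. x \<in> S \<longrightarrow> f x = g x"
      using ae S by (subst (asm) AE_restrict_space_iff) auto
    then show "AE x in lebesgue. (if x \<in> S then f x else 0) = (if x \<in> S then g x else 0)"
      by eventually_elim auto
  qed
qed

section \<open>Traces and the flux identity on the interval\<close>

text \<open>
  The product rule for an absolutely continuous function, whose derivative \<open>f'\<close> is only known as an
  integrable function. On a short interval \<open>{u..v}\<close> the increment of \<open>f \<bullet> A f\<close> equals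
  \<open>(f u + f v) \<bullet> A (f v - f u)\<close>, the integral of \<open>(f u + f v) \<bullet> A (f' t)\<close>. By continuity of \<open>f\<close> it differs
  from the integral of \<open>2 * (f t \<bullet> A (f' t))\<close> by at most \<open>e\<close> times the integral of \<open>norm (f' t)\<close>. This
  error bound is additive over adjacent intervals, so that the bisection principle \<open>Bolzano\<close> extends it
  from short intervals to \<open>{a..b}\<close>; then \<open>e\<close> tends to 0.
\<close>

lemma absolutely_continuous_form:
  fixes f f' :: "real \<Rightarrow> 'a::euclidean_space" and A :: "'a \<Rightarrow> 'a"
  assumes A: "bounded_linear A" and sym: "\<And>u w. u \<bullet> A w = A u \<bullet> w"
    and f': "f' absolutely_integrable_on {a..b}" and "a \<le> b"
    and f: "\<And>x y. a \<le> x \<Longrightarrow> x \<le> y \<Longrightarrow> y \<le> b \<Longrightarrow> f y - f x = integral {x..y} f'"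
  shows "(\<lambda>t. f t \<bullet> A (f' t)) absolutely_integrable_on {a..b}"
    and "integral {a..b} (\<lambda>t. f t \<bullet> A (f' t)) = 1 / 2 * (f b \<bullet> A (f b) - f a \<bullet> A (f a))"
proof -
  interpret A: bounded_linear A by fact
  have int: "f' integrable_on {a..b}" using f' by (simp add: absolutely_integrable_on_def)
  have int': "(\<lambda>t. norm (f' t)) integrable_on {a..b}" using f' by (simp add: absolutely_integrable_on_def)
  have cont: "continuous_on {a..b} f"
  proof (rule continuous_on_eq)
    show "continuous_on {a..b} (\<lambda>t. f a + integral {a..t} f')"
      by (intro continuous_intros indefinite_integral_continuous_1 int)
    show "f a + integral {a..t} f' = f t" if "t \<in> {a..b}" for t
      using f[of a t] that by (auto simp: algebra_simps)
  qed
  have bil: "bilinear (\<lambda>u w. u \<bullet> A w)"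
    by (auto simp: bilinear_def A.add A.scaleR inner_add_left inner_add_right intro!: linearI)
  show abs_int: "(\<lambda>t. f t \<bullet> A (f' t)) absolutely_integrable_on {a..b}"
    by (rule absolutely_integrable_bounded_measurable_product[OF bil _ _ _ f'])
      (auto intro: cont continuous_imp_measurable_on_sets_lebesgue compact_imp_bounded compact_continuous_image)
  obtain K where K: "K > 0" "\<And>w. norm (A w) \<le> norm w * K" using A.pos_bounded by blast
  define g where "g t = 2 * (f t \<bullet> A (f' t))" for t
  define \<phi> where "\<phi> t = f t \<bullet> A (f t)" for t
  have g: "g integrable_on {a..b}"
    using abs_int unfolding g_def by (intro integrable_on_mult_right) (simp add: absolutely_integrable_on_def)
  define P where "P e u v \<longleftrightarrow> (a \<le> u \<longrightarrow> u \<le> v \<longrightarrow> v \<le> b \<longrightarrow>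
    \<bar>\<phi> v - \<phi> u - integral {u..v} g\<bar> \<le> e * integral {u..v} (\<lambda>t. norm (f' t)))" for e u v
  have P: "P e a b" if "e > 0" for e
    using \<open>a \<le> b\<close>
  proof (induction rule: Bolzano)
    case (trans u v w)
    show ?case
      unfolding P_def
    proof (intro impI)
      assume *: "a \<le> u" "u \<le> w" "w \<le> b"
      have 1: "integral {u..w} g = integral {u..v} g + integral {v..w} g"
        by (rule Henstock_Kurzweil_Integration.integral_combine[symmetric])
          (use * trans integrable_on_subinterval[OF g] in auto)
      have 2: "integral {u..w} (\<lambda>t. norm (f' t)) = integral {u..v} (\<lambda>t. norm (f' t)) + integral {v..w} (\<lambda>t. norm (f' t))"
        by (rule Henstock_Kurzweil_Integration.integral_combine[symmetric])
          (use * trans integrable_on_subinterval[OF int'] in auto)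
      show "\<bar>\<phi> w - \<phi> u - integral {u..w} g\<bar> \<le> e * integral {u..w} (\<lambda>t. norm (f' t))"
        using trans * unfolding P_def 1 2 distrib_left by linarith
    qed
  next
    case (local x)
    \<comment> \<open>The integrand below is bounded by \<open>4 * \<eta> * K * norm (f' t)\<close>: each of \<open>f u\<close>, \<open>f v\<close> and, counted
      twice, \<open>f t\<close> is within \<open>\<eta>\<close> of \<open>f x\<close>.\<close>
    define \<eta> where "\<eta> = e / (4 * K)"
    have "\<eta> > 0" using K that by (simp add: \<eta>_def)
    then obtain \<delta> where \<delta>: "\<delta> > 0" "\<And>t. t \<in> {a..b} \<Longrightarrow> dist t x < \<delta> \<Longrightarrow> dist (f t) (f x) < \<eta>"
      using cont local unfolding continuous_on_iff by (metis atLeastAtMost_iff)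
    show ?case
    proof (intro exI[of _ \<delta>] conjI \<open>\<delta> > 0\<close> allI impI, elim conjE)
      fix u v assume uv: "u \<le> x" "x \<le> v" "v - u < \<delta>"
      show "P e u v"
        unfolding P_def
      proof (intro impI)
        assume *: "a \<le> u" "u \<le> v" "v \<le> b"
        have sub: "{u..v} \<subseteq> {a..b}" using * by auto
        have iu: "f' integrable_on {u..v}" "(\<lambda>t. norm (f' t)) integrable_on {u..v}" "g integrable_on {u..v}"
          using integrable_on_subinterval[OF _ sub] int int' g by auto
        define c where "c = f u + f v"
        have lin: "bounded_linear (\<lambda>w. c \<bullet> A w)"
          by (intro bounded_linear_inner_right_comp A)
        have near: "norm (f t - f x) \<le> \<eta>" if "t \<in> {u..v}" for t
          using \<delta>(2)[of t] that uv sub by (auto simp: dist_norm intro: less_imp_le)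
        have "f u \<bullet> A (f v) = f v \<bullet> A (f u)" by (metis sym inner_commute)
        then have "\<phi> v - \<phi> u = c \<bullet> A (f v - f u)"
          by (simp add: \<phi>_def c_def A.diff inner_add_left inner_diff_right)
        also have "f v - f u = integral {u..v} f'" using * by (intro f)
        also have "c \<bullet> A (integral {u..v} f') = integral {u..v} (\<lambda>t. c \<bullet> A (f' t))"
          using integral_linear[OF iu(1) lin] by (simp add: o_def)
        finally have "\<phi> v - \<phi> u - integral {u..v} g = integral {u..v} (\<lambda>t. c \<bullet> A (f' t) - g t)"
          using integrable_linear[OF iu(1) lin] iu(3)
          by (simp add: Henstock_Kurzweil_Integration.integral_diff o_def)
        also have "\<bar>\<dots>\<bar> \<le> integral {u..v} (\<lambda>t. e * norm (f' t))"
          unfolding real_norm_def[symmetric]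
        proof (rule integral_norm_bound_integral)
          show "(\<lambda>t. c \<bullet> A (f' t) - g t) integrable_on {u..v}"
            using integrable_linear[OF iu(1) lin] iu(3) by (auto simp: o_def intro: integrable_diff)
          show "(\<lambda>t. e * norm (f' t)) integrable_on {u..v}"
            using iu(2) by (rule integrable_on_mult_right)
          fix t assume t: "t \<in> {u..v}"
          have "c \<bullet> A (f' t) - g t = (((f u - f x) + (f v - f x)) - 2 *\<^sub>R (f t - f x)) \<bullet> A (f' t)"
            by (simp add: c_def g_def algebra_simps)
          also have "norm \<dots> \<le> norm (((f u - f x) + (f v - f x)) - 2 *\<^sub>R (f t - f x)) * norm (A (f' t))"
            by (simp add: Cauchy_Schwarz_ineq2)
          also have "\<dots> \<le> (4 * \<eta>) * (norm (f' t) * K)"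
          proof (intro mult_mono)
            have "norm (((f u - f x) + (f v - f x)) - 2 *\<^sub>R (f t - f x)) \<le> norm ((f u - f x) + (f v - f x)) + norm (2 *\<^sub>R (f t - f x))"
              by (rule norm_triangle_ineq4)
            also have "\<dots> \<le> norm (f u - f x) + norm (f v - f x) + 2 * norm (f t - f x)"
              using norm_triangle_ineq[of "f u - f x" "f v - f x"] by simp
            also have "\<dots> \<le> 4 * \<eta>" using near[of u] near[of v] near[of t] t * by auto
            finally show "norm (((f u - f x) + (f v - f x)) - 2 *\<^sub>R (f t - f x)) \<le> 4 * \<eta>" .
          qed (use K \<open>\<eta> > 0\<close> in auto)
          also have "\<dots> = e * norm (f' t)" using K by (simp add: \<eta>_def)
          finally show "norm (c \<bullet> A (f' t) - g t) \<le> e * norm (f' t)" .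
        qed
        also have "\<dots> = e * integral {u..v} (\<lambda>t. norm (f' t))" by simp
        finally show "\<bar>\<phi> v - \<phi> u - integral {u..v} g\<bar> \<le> e * integral {u..v} (\<lambda>t. norm (f' t))" .
      qed
    qed
  qed
  define M where "M = integral {a..b} (\<lambda>t. norm (f' t))"
  have "M \<ge> 0" unfolding M_def by (intro integral_nonneg int') auto
  have "\<bar>\<phi> b - \<phi> a - integral {a..b} g\<bar> \<le> 0 + e" if "e > 0" for e
  proof -
    \<comment> \<open>Adding 1 avoids a division by zero when \<open>f'\<close> vanishes almost everywhere.\<close>
    have "\<bar>\<phi> b - \<phi> a - integral {a..b} g\<bar> \<le> e / (M + 1) * M"
      using P[of "e / (M + 1)"] that \<open>M \<ge> 0\<close> \<open>a \<le> b\<close> by (simp add: P_def M_def)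
    also have "\<dots> \<le> e" using that \<open>M \<ge> 0\<close> by (simp add: field_simps)
    finally show ?thesis by simp
  qed
  then have "\<bar>\<phi> b - \<phi> a - integral {a..b} g\<bar> \<le> 0" by (rule field_le_epsilon)
  then have "integral {a..b} g = \<phi> b - \<phi> a" by simp
  moreover have "integral {a..b} g = 2 * integral {a..b} (\<lambda>t. f t \<bullet> A (f' t))"
    unfolding g_def[abs_def] by simp
  ultimately show "integral {a..b} (\<lambda>t. f t \<bullet> A (f' t)) = 1 / 2 * (f b \<bullet> A (f b) - f a \<bullet> A (f a))"
    by (simp add: \<phi>_def)
qed

lemma piecewise_constant_locally:
  assumes "finite D" and const: "\<forall>x y. l \<le> x \<and> x \<le> y \<and> y \<le> r \<and> {x..y} \<inter> D = {} \<longrightarrow> f x = f y"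
    and t: "t \<in> {l..r} - D"
  obtains e :: real where "e > 0" "\<And>y. y \<in> {l..r} \<Longrightarrow> \<bar>y - t\<bar> < e \<Longrightarrow> f y = f t"
proof -
  have "open (- D)" using \<open>finite D\<close> by (simp add: finite_imp_closed open_Compl)
  then obtain e where e: "e > 0" "ball t e \<subseteq> - D" using t by (auto elim: openE)
  show ?thesis
  proof (rule that[OF e(1)])
    fix y assume y: "y \<in> {l..r}" "\<bar>y - t\<bar> < e"
    have "{y..t} \<inter> D = {}" "{t..y} \<inter> D = {}"
      using e(2) y by (auto simp: subset_eq dist_real_def)
    then have "y \<le> t \<longrightarrow> f y = f t" "t \<le> y \<longrightarrow> f t = f y"
      using const y(1) t by (metis Diff_iff atLeastAtMost_iff)+
    then show "f y = f t" by (metis linear)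
  qed
qed

lemma piecewise_constant_measurable:
  fixes f :: "real \<Rightarrow> 'a::euclidean_space"
  assumes "piecewise_constant_on l r f"
  shows "f \<in> borel_measurable (lebesgue_on {l..r})"
proof -
  obtain D where D: "finite D" "\<forall>x y. l \<le> x \<and> x \<le> y \<and> y \<le> r \<and> {x..y} \<inter> D = {} \<longrightarrow> f x = f y"
    using assms by (auto simp: piecewise_constant_on_def)
  have cont: "continuous_on ({l..r} - D) f"
    unfolding continuous_on_iff
  proof (intro ballI allI impI)
    fix t and \<epsilon> :: real assume t: "t \<in> {l..r} - D" and "\<epsilon> > 0"
    obtain e where e: "e > 0" "\<And>y. y \<in> {l..r} \<Longrightarrow> \<bar>y - t\<bar> < e \<Longrightarrow> f y = f t"
      using piecewise_constant_locally[OF D t] by blast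
    show "\<exists>\<delta>>0. \<forall>y\<in>{l..r} - D. dist y t < \<delta> \<longrightarrow> dist (f y) (f t) < \<epsilon>"
      using e \<open>\<epsilon> > 0\<close> by (intro exI[of _ e]) (auto simp: dist_real_def)
  qed
  have "{l..r} - D \<in> sets lebesgue"
    by (intro sets.Diff negligible_imp_sets[OF negligible_finite[OF D(1)]]) simp
  with cont have "f \<in> borel_measurable (lebesgue_on ({l..r} - D))"
    by (rule continuous_imp_measurable_on_sets_lebesgue)
  moreover have "{l..r} - D = {l..r} - D \<inter> {l..r}" by auto
  ultimately have "f \<in> borel_measurable (lebesgue_on ({l..r} - D \<inter> {l..r}))" by (simp only:)
  moreover have "D \<inter> {l..r} \<in> null_sets (lebesgue_on {l..r})"
    using D(1) by (subst null_sets_restrict_space) (simp_all add: negligible_finite flip: negligible_iff_null_sets)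
  ultimately show ?thesis
    by (subst (asm) borel_measurable_diff_null) simp_all
qed

lemma jumps_subset:
  assumes "finite D" "\<forall>x y. -1 \<le> x \<and> x \<le> y \<and> y \<le> 1 \<and> {x..y} \<inter> D = {} \<longrightarrow> d x = d y"
  shows "jumps d \<subseteq> D"
proof (rule ccontr)
  assume "\<not> jumps d \<subseteq> D"
  then obtain t where t: "t \<in> {-1<..<1}" "\<not> isCont d t" "t \<notin> D" by (auto simp: jumps_def)
  have t': "t \<in> {-1..1} - D" using t by auto
  obtain e where e: "e > 0" "\<And>y. y \<in> {-1..1} \<Longrightarrow> \<bar>y - t\<bar> < e \<Longrightarrow> d y = d t"
    using piecewise_constant_locally[OF assms t'] by blast
  have "eventually (\<lambda>y. y \<in> {-1<..<1} \<inter> ball t e) (nhds t)"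
    using t(1) e(1) by (intro eventually_nhds_in_open) auto
  then have "eventually (\<lambda>y. d y = d t) (nhds t)"
  proof eventually_elim
    case (elim y)
    then show ?case using e(2)[of y] by (simp add: dist_real_def abs_minus_commute)
  qed
  then have "isCont d t" using isCont_cong[of d "\<lambda>_. d t" t] by simp
  with t(2) show False by simp
qed

lemma finite_jumps: "piecewise_constant_on (-1) 1 d \<Longrightarrow> finite (jumps d)"
  unfolding piecewise_constant_on_def using jumps_subset finite_subset by metis

lemma square_integrable_imp_integrable:
  fixes f :: "'a::euclidean_space \<Rightarrow> 'b::euclidean_space"
  assumes "square_integrable_on f S" "S \<in> lmeasurable"
  shows "integrable (lebesgue_on S) f"
proof -
  interpret finite_measure "lebesgue_on S" using assms(2) by (rule finite_measure_lebesgue_on)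
  have f: "f \<in> borel_measurable (lebesgue_on S)" "integrable (lebesgue_on S) (\<lambda>x. (norm (f x))\<^sup>2)"
    using assms(1) by (auto simp: square_integrable_on_def)
  show ?thesis
  proof (rule Bochner_Integration.integrable_bound[OF _ f(1)])
    show "integrable (lebesgue_on S) (\<lambda>x. 1 + (norm (f x))\<^sup>2)" using f(2) by simp
    have "norm (f x) \<le> 1 + (norm (f x))\<^sup>2" for x
      using zero_le_power2[of "norm (f x) - 1 / 2"] by (simp add: power2_eq_square algebra_simps)
    then show "AE x in lebesgue_on S. norm (f x) \<le> norm (1 + (norm (f x))\<^sup>2)"
      by (intro AE_I2) (metis abs_ge_self order_trans real_norm_def)
  qed
qed

text \<open>
  The states \<open>Q\<close> and \<open>I\<close>, the integral of \<open>Q'\<close>, differ by a piecewise constant \<open>E\<close>. The jumps of \<open>E\<close> are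
  those of \<open>Q\<close>, and \<open>A_x\<close> annihilates them by the interface conditions. Hence \<open>A_x *v Q\<close>, once its
  arbitrary values at the interfaces are replaced by one-sided limits, differs from \<open>A_x *v I\<close> by a
  constant on the whole interval and is absolutely continuous there. The product rule applies to it,
  and \<open>A_x_cube\<close> translates the result back to \<open>Q\<close>.
\<close>

lemma integral_flux:
  assumes d: "piecewise_constant_on (-1) 1 d"
    and reg: "piecewise_H1 (jumps d) Q Q'"
    and interf: "interface_conditions (jumps d) Q"
  shows "Q \<in> borel_measurable (lebesgue_on {-1..1})"
    and "integrable (lebesgue_on {-1..1}) (\<lambda>t. Q t \<bullet> (A_x *v Q' t))"
    and "(LINT t|lebesgue_on {-1..1}. Q t \<bullet> (A_x *v Q' t)) =
      1 / 2 * (Q 1 \<bullet> (A_x *v Q 1) - Q (-1) \<bullet> (A_x *v Q (-1)))"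
proof -
  let ?J = "jumps d"
  have J: "finite ?J" "?J \<subseteq> {-1<..<1}" using finite_jumps[OF d] by (auto simp: jumps_def)
  have Q': "integrable (lebesgue_on {-1..1}) Q'"
    using reg by (intro square_integrable_imp_integrable) (auto simp: piecewise_H1_def)
  have Q'abs: "Q' absolutely_integrable_on {-1..1}"
    using Q' by (simp add: integrable_restrict_space set_integrable_def)
  have int: "Q' integrable_on {-1..1}" using Q'abs by (simp add: absolutely_integrable_on_def)
  define I where "I t = integral {-1..t} Q'" for t
  have I: "continuous_on {-1..1} I"
    unfolding I_def by (rule indefinite_integral_continuous_1[OF int])
  have I_diff: "I y - I x = integral {x..y} Q'" if "-1 \<le> x" "x \<le> y" "y \<le> 1" for x y
  proof -
    have "integral {-1..x} Q' + integral {x..y} Q' = integral {-1..y} Q'"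
      using that by (intro Henstock_Kurzweil_Integration.integral_combine integrable_on_subinterval[OF int]) auto
    then show ?thesis unfolding I_def by (metis add_diff_cancel_left')
  qed
  define E where "E t = Q t - I t" for t
  have E: "\<forall>x y. -1 \<le> x \<and> x \<le> y \<and> y \<le> 1 \<and> {x..y} \<inter> ?J = {} \<longrightarrow> E x = E y"
  proof (intro allI impI, elim conjE)
    fix x y :: real assume xy: "-1 \<le> x" "x \<le> y" "y \<le> 1" "{x..y} \<inter> ?J = {}"
    have "{x..y} \<subseteq> {-1..1} - ?J" using xy by auto
    then have "(LINT t|lebesgue_on {x..y}. Q' t) = Q y - Q x"
      using reg xy by (simp add: piecewise_H1_def)
    moreover have "(LINT t|lebesgue_on {x..y}. Q' t) = integral {x..y} Q'"
      using xy by (intro lebesgue_integral_eq_integral integrable_subinterval[OF Q']) auto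
    ultimately have "Q y - Q x = I y - I x" using I_diff[OF xy(1-3)] by simp
    then show "E x = E y" by (simp add: E_def algebra_simps)
  qed
  have "E \<in> borel_measurable (lebesgue_on {-1..1})"
    using E J(1) by (intro piecewise_constant_measurable) (auto simp: piecewise_constant_on_def)
  moreover have "I \<in> borel_measurable (lebesgue_on {-1..1})"
    using I by (rule continuous_imp_measurable_on_sets_lebesgue) simp
  ultimately have "(\<lambda>t. E t + I t) \<in> borel_measurable (lebesgue_on {-1..1})" by measurable
  then show "Q \<in> borel_measurable (lebesgue_on {-1..1})" by (simp add: E_def)

  \<comment> \<open>Near an interface \<open>x\<close> the step function \<open>E\<close> takes one value on each side; this also shows that the
    one-sided limits of \<open>Q\<close> in the interface conditions exist.\<close>
  have side: "\<exists>e>0. \<exists>cl cr. Lim (at_left x) Q = cl + I x \<and> Lim (at_right x) Q = cr + I x \<and>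
      (\<forall>t\<in>{-1..1}. t \<noteq> x \<longrightarrow> \<bar>t - x\<bar> < e \<longrightarrow> t \<notin> ?J \<and> E t = (if t < x then cl else cr))"
    if x: "x \<in> ?J" for x
  proof -
    have x1: "x \<in> {-1<..<1}" using x J by auto
    have "open ({-1<..<1} - (?J - {x}))" using J(1) by (intro open_Diff finite_imp_closed) auto
    then obtain e where e: "e > 0" "ball x e \<subseteq> {-1<..<1} - (?J - {x})"
      using x1 by (auto elim!: openE)
    have off: "t \<in> {-1<..<1} \<and> t \<notin> ?J" if "t \<noteq> x" "\<bar>t - x\<bar> < e" for t
      using e(2) that by (auto simp: subset_eq dist_real_def)
    define cl cr where "cl = E (x - e / 2)" and "cr = E (x + e / 2)"
    have cl: "E t = cl" if t: "x - e < t" "t < x" for t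
    proof -
      have "{t..x - e / 2} \<inter> ?J = {}" "{x - e / 2..t} \<inter> ?J = {}"
        using off t e(1) by fastforce+
      moreover have "t \<in> {-1<..<1}" "x - e / 2 \<in> {-1<..<1}"
        using off[of t] off[of "x - e / 2"] t e(1) by auto
      ultimately have "t \<le> x - e / 2 \<longrightarrow> E t = E (x - e / 2)" "x - e / 2 \<le> t \<longrightarrow> E (x - e / 2) = E t"
        using E by (meson greaterThanLessThan_iff less_imp_le)+
      then show ?thesis
        unfolding cl_def by (metis linear)
    qed
    have cr: "E t = cr" if t: "x < t" "t < x + e" for t
    proof -
      have "{t..x + e / 2} \<inter> ?J = {}" "{x + e / 2..t} \<inter> ?J = {}"
        using off t e(1) by fastforce+
      moreover have "t \<in> {-1<..<1}" "x + e / 2 \<in> {-1<..<1}"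
        using off[of t] off[of "x + e / 2"] t e(1) by auto
      ultimately have "t \<le> x + e / 2 \<longrightarrow> E t = E (x + e / 2)" "x + e / 2 \<le> t \<longrightarrow> E (x + e / 2) = E t"
        using E by (meson greaterThanLessThan_iff less_imp_le)+
      then show ?thesis
        unfolding cr_def by (metis linear)
    qed
    have "isCont I x" using I x1 by (metis at_within_Icc_at continuous_on_eq_continuous_within greaterThanLessThan_iff
          greaterThanLessThan_subseteq_atLeastAtMost_iff order_refl subsetD)
    then have Il: "(I \<longlongrightarrow> I x) (at_left x)" and Ir: "(I \<longlongrightarrow> I x) (at_right x)"
      unfolding isCont_def by (auto simp: filterlim_at_split)
    have "((\<lambda>t. cl + I t) \<longlongrightarrow> cl + I x) (at_left x)" using Il by (intro tendsto_intros)
    moreover have "eventually (\<lambda>t. t \<in> {x - e<..<x}) (at_left x)"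
      using e(1) by (intro eventually_at_leftI[of "x - e"]) auto
    then have "eventually (\<lambda>t. cl + I t = Q t) (at_left x)"
      by eventually_elim (use cl in \<open>auto simp: E_def algebra_simps\<close>)
    ultimately have "(Q \<longlongrightarrow> cl + I x) (at_left x)" by (rule Lim_transform_eventually)
    then have Ll: "Lim (at_left x) Q = cl + I x" by (intro tendsto_Lim) auto
    have "((\<lambda>t. cr + I t) \<longlongrightarrow> cr + I x) (at_right x)" using Ir by (intro tendsto_intros)
    moreover have "eventually (\<lambda>t. t \<in> {x<..<x + e}) (at_right x)"
      using e(1) by (intro eventually_at_rightI[of _ "x + e"]) auto
    then have "eventually (\<lambda>t. cr + I t = Q t) (at_right x)"
      by eventually_elim (use cr in \<open>auto simp: E_def algebra_simps\<close>)
    ultimately have "(Q \<longlongrightarrow> cr + I x) (at_right x)" by (rule Lim_transform_eventually)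
    then have Lr: "Lim (at_right x) Q = cr + I x" by (intro tendsto_Lim) auto
    show ?thesis
      using e(1) Ll Lr cl cr off
      by (intro exI[of _ e] exI[of _ cl] exI[of _ cr]) (auto simp: abs_if split: if_splits)
  qed

  \<comment> \<open>The left limit at an interface is an arbitrary choice: the right one gives the same \<open>R\<close>.\<close>
  define R where "R x = A_x *v (if x \<in> ?J then Lim (at_left x) Q else Q x)" for x
  define G where "G x = R x - A_x *v I x" for x
  have G: "G x = A_x *v E x" if "x \<notin> ?J" for x
    using that by (simp add: G_def R_def E_def matrix_vector_mult_diff_distrib)
  have G_const: "G u = G v" if "-1 \<le> u" "u \<le> v" "v \<le> 1" for u v
  proof -
    have "-1 \<le> u \<longrightarrow> v \<le> 1 \<longrightarrow> G u = G v"
      using \<open>u \<le> v\<close>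
    proof (induction rule: Bolzano)
      case (local x)
      have "\<exists>e>0. \<forall>t\<in>{-1..1}. \<bar>t - x\<bar> < e \<longrightarrow> G t = G x"
      proof (cases "x \<in> ?J")
        case True
        obtain e cl cr where e: "e > 0" "Lim (at_left x) Q = cl + I x" "Lim (at_right x) Q = cr + I x"
          "\<And>t. t \<in> {-1..1} \<Longrightarrow> t \<noteq> x \<Longrightarrow> \<bar>t - x\<bar> < e \<Longrightarrow> t \<notin> ?J \<and> E t = (if t < x then cl else cr)"
          using side[OF True] by blast
        have "A_x *v (cr + I x) = A_x *v (cl + I x)"
          unfolding e(2,3)[symmetric] using interf True
          by (intro A_x_mult_cong) (auto simp: interface_conditions_def)
        then have c: "A_x *v cr = A_x *v cl" by (simp add: matrix_vector_right_distrib)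
        have Gx: "G x = A_x *v cl"
          using True by (simp add: G_def R_def e(2) matrix_vector_right_distrib)
        have "G t = G x" if "t \<in> {-1..1}" "\<bar>t - x\<bar> < e" for t
          using e(4)[OF that(1) _ that(2)] G[of t] c Gx by (cases "t = x") (auto split: if_splits)
        then show ?thesis using e(1) by blast
      next
        case False
        have "x \<in> {-1..1} - ?J" using False local that by auto
        then obtain e where e: "e > 0" "\<And>y. y \<in> {-1..1} \<Longrightarrow> \<bar>y - x\<bar> < e \<Longrightarrow> E y = E x"
          using piecewise_constant_locally[OF J(1) E] by blast
        have "open (- ?J)" using J(1) by (simp add: finite_imp_closed open_Compl)
        then obtain e' where e': "e' > 0" "ball x e' \<subseteq> - ?J" using False by (auto elim: openE)
        have "G t = G x" if "t \<in> {-1..1}" "\<bar>t - x\<bar> < min e e'" for t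
        proof -
          have "t \<notin> ?J" using e'(2) that by (auto simp: subset_eq dist_real_def)
          then show ?thesis using G[of t] G[OF False] e(2)[of t] that by simp
        qed
        then show ?thesis using e(1) e'(1) by (intro exI[of _ "min e e'"]) simp
      qed
      then obtain e where e: "e > 0" "\<And>t. t \<in> {-1..1} \<Longrightarrow> \<bar>t - x\<bar> < e \<Longrightarrow> G t = G x"
        by blast
      show ?case
      proof (intro exI[of _ e] conjI e(1) allI impI, elim conjE)
        fix u v assume uv: "u \<le> x" "x \<le> v" "v - u < e" "-1 \<le> u" "v \<le> 1"
        have "G u = G x" "G v = G x" by (rule e(2); use uv in force)+
        then show "G u = G v" by simp
      qed
    qed auto
    then show ?thesis using that by simp
  qed
  have lin: "bounded_linear ((*v) A_x)" by (rule matrix_vector_mul_bounded_linear)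
  have R_diff: "R y - R x = integral {x..y} (\<lambda>t. A_x *v Q' t)" if "-1 \<le> x" "x \<le> y" "y \<le> 1" for x y
  proof -
    have "integral {x..y} (\<lambda>t. A_x *v Q' t) = A_x *v integral {x..y} Q'"
      using integral_linear[OF integrable_on_subinterval[OF int] lin, of x y] that by (simp add: o_def)
    also have "\<dots> = A_x *v (I y - I x)" using I_diff[OF that] by simp
    also have "\<dots> = R y - R x"
      using G_const[OF that] by (simp add: G_def matrix_vector_mult_diff_distrib algebra_simps)
    finally show ?thesis ..
  qed
  have AQ': "(\<lambda>t. A_x *v Q' t) absolutely_integrable_on {-1..1}"
    using absolutely_integrable_linear[OF Q'abs lin] by (simp add: o_def)
  note form = absolutely_continuous_form[OF lin A_x_self_adjoint AQ' _ R_diff, simplified]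
  have flux: "(A_x *v p) \<bullet> (A_x *v (A_x *v q)) = p \<bullet> (A_x *v q)" for p q
    by (simp add: A_x_self_adjoint[symmetric] A_x_cube)
  have eq: "R t \<bullet> (A_x *v (A_x *v Q' t)) = Q t \<bullet> (A_x *v Q' t)" if "t \<in> {-1..1} - ?J" for t
    using that by (simp add: R_def flux)
  have ends: "-1 \<notin> ?J" "1 \<notin> ?J" using J(2) by auto
  have neg: "negligible ?J" using J(1) by (rule negligible_finite)
  have abs: "(\<lambda>t. Q t \<bullet> (A_x *v Q' t)) absolutely_integrable_on {-1..1}"
    by (rule absolutely_integrable_spike[OF form(1) neg]) (simp add: eq)
  show i: "integrable (lebesgue_on {-1..1}) (\<lambda>t. Q t \<bullet> (A_x *v Q' t))"
    by (rule absolutely_integrable_imp_integrable[OF abs]) simp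
  have "(LINT t|lebesgue_on {-1..1}. Q t \<bullet> (A_x *v Q' t)) = integral {-1..1} (\<lambda>t. Q t \<bullet> (A_x *v Q' t))"
    by (rule lebesgue_integral_eq_integral[OF i]) simp
  also have "\<dots> = integral {-1..1} (\<lambda>t. R t \<bullet> (A_x *v (A_x *v Q' t)))"
    by (rule integral_spike[OF neg]) (simp add: eq)
  also have "\<dots> = 1 / 2 * (R 1 \<bullet> (A_x *v R 1) - R (-1) \<bullet> (A_x *v R (-1)))"
    using form(2) by simp
  also have "\<dots> = 1 / 2 * (Q 1 \<bullet> (A_x *v Q 1) - Q (-1) \<bullet> (A_x *v Q (-1)))"
    using ends by (simp add: R_def flux)
  finally show "(LINT t|lebesgue_on {-1..1}. Q t \<bullet> (A_x *v Q' t)) =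
      1 / 2 * (Q 1 \<bullet> (A_x *v Q 1) - Q (-1) \<bullet> (A_x *v Q (-1)))" .
qed

section \<open>The energy estimate\<close>

theorem theorem1:
  fixes \<rho> cp cs :: "real ^ 3 \<Rightarrow> real" and C :: "real ^ 3 \<Rightarrow> real ^ 6 ^ 6"
    and d \<alpha> :: "real \<Rightarrow> real" and \<gamma> :: "3 \<Rightarrow> real"
    and s :: complex and a :: real
    and Q Q' FQ Fw :: "real \<Rightarrow> state"
  assumes material_measurable: "\<rho> \<in> borel_measurable (lebesgue_on Omega)"
      "C \<in> borel_measurable (lebesgue_on Omega)"
    and density: "\<And>p. p \<in> Omega \<Longrightarrow> \<rho> p > 0"
    and stiffness: "\<And>p. p \<in> Omega \<Longrightarrow> sym_pos_def (C p)"
    and wave_speeds: "\<And>p. p \<in> Omega \<Longrightarrow> cp p > 0" "\<And>p. p \<in> Omega \<Longrightarrow> cs p > 0"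
    and damping: "piecewise_constant_on (-1) 1 d" "\<And>x. x \<in> {-1..1} \<Longrightarrow> d x \<ge> 0"
    and shift: "piecewise_constant_on (-1) 1 \<alpha>" "\<And>x. x \<in> {-1..1} \<Longrightarrow> \<alpha> x \<ge> 0"
    and reflection: "\<And>\<eta>. \<bar>\<gamma> \<eta>\<bar> \<le> 1"
    and laplace: "Re s \<ge> a" "a > 0"
    and sources: "square_integrable_on (strip FQ) Omega" "square_integrable_on (strip Fw) Omega"
      "finite_P_norm (P_mat \<rho> C) (source (P_mat \<rho> C) d \<alpha> s FQ Fw)"
    and regularity: "piecewise_H1 (jumps d) Q Q'"
    and equation: "strip_equation (P_mat \<rho> C) d \<alpha> s Q Q' (source (P_mat \<rho> C) d \<alpha> s FQ Fw)"
    and boundary: "boundary_conditions (impedance \<rho> cp cs) \<gamma> Q"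
    and interfaces: "interface_conditions (jumps d) Q"
  shows "(\<forall>x\<in>{-1..1}. Re (s * S_x d \<alpha> s x) \<ge> a) \<and>
    (P_norm (P_mat \<rho> C) (strip (\<lambda>x. sqrt (Re (s * S_x d \<alpha> s x)) *\<^sub>R Q x)))\<^sup>2
      \<le> P_norm (P_mat \<rho> C) (strip Q) * P_norm (P_mat \<rho> C) (source (P_mat \<rho> C) d \<alpha> s FQ Fw)
         + 1 / 2 * boundary_term Q \<and>
    boundary_term Q \<le> 0"
proof -
  let ?P = "P_mat \<rho> C" and ?L = "lebesgue_on Omega"
  define F where "F = source ?P d \<alpha> s FQ Fw"
  define M where "M p = cmat (matrix_inv (?P p))" for p :: "real ^ 3"
  define r where "r x = Re (s * S_x d \<alpha> s x)" for x
  have Om: "Omega \<in> sets lebesgue" by (simp add: Omega_def)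
  have Om1: "p $ 1 \<in> {-1..1}" if "p \<in> Omega" for p
    using measurable_space[OF measurable_first_coordinate, of p] that by simp
  have r: "r x \<ge> a" if "x \<in> {-1..1}" for x
    unfolding r_def by (rule Re_symbol_ge[OF laplace]) (use damping shift that in auto)
  have spd: "sym_pos_def (?P p)" if "p \<in> Omega" for p
    using density stiffness that by (intro sym_pos_def_P_mat)
  note inv = sym_pos_def_inverse[OF spd]
  have M_psd: "u \<bullet> (M p *v u) \<ge> 0" if "p \<in> Omega" for p u
    unfolding M_def by (rule cmat_form_nonneg) (rule inv(3)[OF that])
  have M_bound: "2 * t * (u \<bullet> (M p *v w)) \<le> t\<^sup>2 * (u \<bullet> (M p *v u)) + w \<bullet> (M p *v w)" if "p \<in> Omega" for p t u w
    unfolding M_def by (rule cmat_form_bound) (rule inv(2,3)[OF that])+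
  have norm_eq: "P_norm ?P U = sqrt (1 / 2 * (LINT p|?L. U p \<bullet> (M p *v U p)))"
    "finite_P_norm ?P U \<longleftrightarrow> integrable ?L (\<lambda>p. U p \<bullet> (M p *v U p))" for U
    unfolding M_def by (rule P_norm_eq, rule inv(2), assumption)+

  define q where "q p = Q (p $ 1) \<bullet> (M p *v Q (p $ 1))" for p :: "real ^ 3"
  define b where "b p = Q (p $ 1) \<bullet> (M p *v F p)" for p :: "real ^ 3"
  define f where "f p = F p \<bullet> (M p *v F p)" for p :: "real ^ 3"
  define k where "k p = Q (p $ 1) \<bullet> (A_x *v Q' (p $ 1))" for p :: "real ^ 3"
  note flux = integral_flux[OF damping(1) regularity interfaces]
  have Q_meas [measurable]: "strip Q \<in> borel_measurable ?L"
    by (rule borel_measurable_strip[OF flux(1)])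
  have k: "integrable ?L k" unfolding k_def by (rule integral_strip(1)[OF flux(2)])
  \<comment> \<open>Four (the cross-section) times one half (the product rule) of the flux difference is exactly
    \<open>boundary_term Q\<close>; the weight \<open>1 / 2\<close> of the norm is still to come.\<close>
  have "(LINT p|?L. k p) = 4 * (1 / 2 * (Q 1 \<bullet> (A_x *v Q 1) - Q (-1) \<bullet> (A_x *v Q (-1))))"
    unfolding k_def by (subst integral_strip(2)[OF flux(2)]) (simp only: flux(3))
  then have k_int: "(LINT p|?L. k p) = boundary_term Q"
    by (simp add: boundary_term_eq)
  have f: "integrable ?L f" using sources(3) unfolding norm_eq(2) f_def F_def .

  have [measurable]: "d \<in> borel_measurable (lebesgue_on {-1..1})" "\<alpha> \<in> borel_measurable (lebesgue_on {-1..1})"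
    using damping(1) shift(1) by (auto intro: piecewise_constant_measurable)
  have S_meas: "S_x d \<alpha> s \<in> borel_measurable (lebesgue_on {-1..1})"
    unfolding S_x_def[abs_def] by measurable
  note [measurable] = borel_measurable_strip[OF S_meas]
  have w_meas: "(\<lambda>x. of_real (d x) / (s + of_real (\<alpha> x))) \<in> borel_measurable (lebesgue_on {-1..1})" (is "?w \<in> _")
    by measurable
  note [measurable] = borel_measurable_strip[OF w_meas]
  have [measurable]: "strip FQ \<in> borel_measurable ?L" "strip Fw \<in> borel_measurable ?L"
    using sources by (auto simp: square_integrable_on_def)
  \<comment> \<open>The source carries the factor \<open>P\<close>, which \<open>M\<close> cancels, so that \<open>M F\<close> is the combination \<open>G\<close> of
    fields on the strip.\<close>
  define G where "G p = S_x d \<alpha> s (p $ 1) *s FQ (p $ 1) - ?w (p $ 1) *s Fw (p $ 1)" for p :: "real ^ 3"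
  have "G \<in> borel_measurable ?L" unfolding G_def[abs_def] by measurable
  then have "(\<lambda>p. Q (p $ 1) \<bullet> G p) \<in> borel_measurable ?L" by measurable
  moreover have "M p *v F p = G p" if "p \<in> Omega" for p
    unfolding M_def F_def source_def cmat_mult inv(1)[OF that] cmat_mat_1 G_def by simp
  ultimately have b_meas: "b \<in> borel_measurable ?L"
    unfolding b_def by (subst measurable_cong[where g = "\<lambda>p. Q (p $ 1) \<bullet> G p"]) auto
  have r_meas [measurable]: "strip r \<in> borel_measurable ?L"
    unfolding r_def[abs_def] by measurable

  have balance: "AE p in ?L. r (p $ 1) * q p = k p + b p"
    using equation[unfolded strip_equation_def, folded F_def M_def] AE_space
  proof eventually_elim
    fix p
    assume eq: "(s * S_x d \<alpha> s (p $ 1)) *s (M p *v Q (p $ 1)) = A_x *v Q' (p $ 1) + M p *v F p"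
      and "p \<in> space ?L"
    then have p: "p \<in> Omega" by simp
    have h: "hdot (Q (p $ 1)) (M p *v Q (p $ 1)) = of_real (q p)"
      unfolding q_def M_def by (rule hdot_cmat_self[OF inv(2)[OF p]])
    have "Q (p $ 1) \<bullet> ((s * S_x d \<alpha> s (p $ 1)) *s (M p *v Q (p $ 1))) =
        Re (s * S_x d \<alpha> s (p $ 1) * of_real (q p))"
      by (simp only: Re_hdot[symmetric] hdot_scalar h)
    also have "\<dots> = r (p $ 1) * q p" by (simp add: r_def)
    finally have "Q (p $ 1) \<bullet> ((s * S_x d \<alpha> s (p $ 1)) *s (M p *v Q (p $ 1))) = r (p $ 1) * q p" .
    then show "r (p $ 1) * q p = k p + b p"
      unfolding eq by (simp add: k_def b_def inner_add_right)
  qed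
  have q_meas: "q \<in> borel_measurable ?L"
  proof (rule borel_measurable_lebesgue_on_AE[OF _ Om])
    show "(\<lambda>p. (k p + b p) / r (p $ 1)) \<in> borel_measurable ?L"
      using k b_meas by measurable
    show "AE p in ?L. (k p + b p) / r (p $ 1) = q p"
      using balance AE_space
    proof eventually_elim
      fix p assume "r (p $ 1) * q p = k p + b p" "p \<in> space ?L"
      moreover have "r (p $ 1) > 0" using r[OF Om1, of p] laplace(2) \<open>p \<in> space ?L\<close> by simp
      ultimately show "(k p + b p) / r (p $ 1) = q p" by (simp add: field_simps)
    qed
  qed
  \<comment> \<open>Young's inequality with weight \<open>a\<close>: from \<open>a * q \<le> \<bar>k\<bar> + b\<close> and \<open>b \<le> a / 2 * q + f / (2 * a)\<close>, half of
    \<open>a * q\<close> is absorbed on the left.\<close>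
  have q: "integrable ?L q"
  proof (rule Bochner_Integration.integrable_bound[OF _ q_meas])
    show "integrable ?L (\<lambda>p. 2 / a * \<bar>k p\<bar> + 1 / a\<^sup>2 * f p)" using k f by simp
    show "AE p in ?L. norm (q p) \<le> norm (2 / a * \<bar>k p\<bar> + 1 / a\<^sup>2 * f p)"
      using balance AE_space
    proof eventually_elim
      fix p assume bal: "r (p $ 1) * q p = k p + b p" and "p \<in> space ?L"
      then have p: "p \<in> Omega" by simp
      have q0: "q p \<ge> 0" unfolding q_def by (rule M_psd[OF p])
      have "a * q p \<le> r (p $ 1) * q p" using r[OF Om1[OF p]] q0 by (rule mult_right_mono)
      then have 1: "a * q p \<le> \<bar>k p\<bar> + b p" unfolding bal by linarith
      have "2 * a * b p \<le> a\<^sup>2 * q p + f p" unfolding b_def q_def f_def by (rule M_bound[OF p])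
      moreover have "2 * a * (a * q p) \<le> 2 * a * (\<bar>k p\<bar> + b p)" using 1 laplace(2) by simp
      ultimately have "a\<^sup>2 * q p \<le> 2 * a * \<bar>k p\<bar> + f p"
        by (simp add: power2_eq_square algebra_simps)
      then have "q p \<le> (2 * a * \<bar>k p\<bar> + f p) / a\<^sup>2"
        using laplace(2) by (simp add: pos_le_divide_eq mult.commute)
      also have "\<dots> = 2 / a * \<bar>k p\<bar> + 1 / a\<^sup>2 * f p"
        using laplace(2) by (simp add: power2_eq_square field_simps)
      finally show "norm (q p) \<le> norm (2 / a * \<bar>k p\<bar> + 1 / a\<^sup>2 * f p)" using q0 by simp
    qed
  qed
  have b: "integrable ?L b"
  proof (rule Bochner_Integration.integrable_bound[OF _ b_meas])
    show "integrable ?L (\<lambda>p. (q p + f p) / 2)" using q f by simp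
    show "AE p in ?L. norm (b p) \<le> norm ((q p + f p) / 2)"
      using AE_space
    proof eventually_elim
      fix p assume "p \<in> space ?L"
      then have p: "p \<in> Omega" by simp
      show "norm (b p) \<le> norm ((q p + f p) / 2)"
        using M_bound[OF p, of 1 "Q (p $ 1)" "F p"] M_bound[OF p, of "-1" "Q (p $ 1)" "F p"]
        by (simp add: b_def q_def f_def)
    qed
  qed
  have rq: "(LINT p|?L. r (p $ 1) * q p) = boundary_term Q + (LINT p|?L. b p)"
  proof -
    have "(LINT p|?L. r (p $ 1) * q p) = (LINT p|?L. k p + b p)"
      using balance borel_measurable_times[OF r_meas q_meas] borel_measurable_add[OF _ b_meas] k
      by (intro integral_cong_AE) auto
    then show ?thesis using k b k_int by simp
  qed
  have cs: "1 / 2 * (LINT p|?L. b p) \<le> sqrt (1 / 2 * (LINT p|?L. q p)) * sqrt (1 / 2 * (LINT p|?L. f p))"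
  proof (rule cauchy_schwarz_from_quadratic)
    have q0: "(LINT p|?L. q p) \<ge> 0"
      by (rule Bochner_Integration.integral_nonneg) (auto simp: q_def M_psd)
    then show "1 / 2 * (LINT p|?L. q p) \<ge> 0" by simp
    fix t
    have "(LINT p|?L. 2 * t * b p) \<le> (LINT p|?L. t\<^sup>2 * q p + f p)"
    proof (rule integral_mono)
      show "integrable ?L (\<lambda>p. 2 * t * b p)" "integrable ?L (\<lambda>p. t\<^sup>2 * q p + f p)"
        using b q f by simp_all
      fix p assume "p \<in> space ?L"
      then show "2 * t * b p \<le> t\<^sup>2 * q p + f p"
        unfolding b_def q_def f_def by (intro M_bound) simp
    qed
    then have "2 * t * (LINT p|?L. b p) \<le> t\<^sup>2 * (LINT p|?L. q p) + (LINT p|?L. f p)"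
      using q f b by simp
    then show "2 * t * (1 / 2 * (LINT p|?L. b p)) \<le> t\<^sup>2 * (1 / 2 * (LINT p|?L. q p)) + 1 / 2 * (LINT p|?L. f p)"
      by simp
  qed
  have "(P_norm ?P (strip (\<lambda>x. sqrt (r x) *\<^sub>R Q x)))\<^sup>2 = 1 / 2 * (LINT p|?L. r (p $ 1) * q p)"
  proof -
    have eq: "(LINT p|?L. (sqrt (r (p $ 1)) *\<^sub>R Q (p $ 1)) \<bullet> (M p *v (sqrt (r (p $ 1)) *\<^sub>R Q (p $ 1)))) =
      (LINT p|?L. r (p $ 1) * q p)"
    proof (rule Bochner_Integration.integral_cong)
      fix p assume "p \<in> space ?L"
      then have "r (p $ 1) \<ge> 0" using r[OF Om1, of p] laplace(2) by simp
      moreover have "M p *v (c *\<^sub>R u) = c *\<^sub>R (M p *v u)" for c u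
        by (rule linear_scale[OF bounded_linear.linear[OF matrix_vector_mul_bounded_linear]])
      ultimately show "(sqrt (r (p $ 1)) *\<^sub>R Q (p $ 1)) \<bullet> (M p *v (sqrt (r (p $ 1)) *\<^sub>R Q (p $ 1))) = r (p $ 1) * q p"
        by (simp add: q_def flip: mult.assoc)
    qed simp
    have "(LINT p|?L. r (p $ 1) * q p) \<ge> 0"
    proof (rule Bochner_Integration.integral_nonneg)
      fix p assume "p \<in> space ?L"
      then have "p \<in> Omega" by simp
      then show "0 \<le> r (p $ 1) * q p"
        using r[OF Om1, of p] laplace(2) M_psd[of p] by (simp add: q_def)
    qed
    then show ?thesis unfolding norm_eq(1) eq by simp
  qed
  also have "\<dots> \<le> P_norm ?P (strip Q) * P_norm ?P F + 1 / 2 * boundary_term Q"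
    unfolding rq unfolding norm_eq(1) using cs unfolding q_def f_def by simp
  finally have "(P_norm ?P (strip (\<lambda>x. sqrt (r x) *\<^sub>R Q x)))\<^sup>2
      \<le> P_norm ?P (strip Q) * P_norm ?P F + 1 / 2 * boundary_term Q" .
  moreover have "boundary_term Q \<le> 0"
    by (rule boundary_term_nonpos[OF density wave_speeds reflection boundary])
  ultimately show ?thesis using r unfolding r_def F_def by blast
qed

end
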